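(* Let $Y=\mathbb T^{\mathbb Z}$ ($\mathbb T=\mathbb R/\mathbb Z$), $\lambda=\lambda_0^{\otimes\mathbb Z}$ with $\lambda_0$ Lebesgue measure on $\mathbb T$, and $T$ the shift on $Y$, viewed as an element of ${\rm Aut}(Y,\lambda)$. Then: (1) every compact metric topologically transitive system is topologically isomorphic to a (closed $\widetilde T$-invariant) subsystem of $(C_2(\lambda),\widetilde T)$ contained in the $\widetilde T$-invariant dense $G_\delta$ set ${\rm Aut}(\lambda)\subset C_2(\lambda)$ of graph couplings; (2) for every ergodic measure-preserving system $(\Omega,\mathcal A,\nu,S)$ on a standard probability space there is an ergodic $\widetilde T$-invariant probability measure $P_\nu$ on $C_2(\lambda)$ concentrated on ${\rm Aut}(\lambda)$ such that $(C_2(\lambda),P_\nu,\widetilde T)$ is measure-theoretically isomorphic to $(\Omega,\mathcal A,\nu,S)$.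
   Context: $C_2(\lambda)$: probability measures on $Y\times Y$ with both marginals $\lambda$, with the compact metrizable topology $\rho_n\to\rho$ iff $\rho_n(A\times B)\to\rho(A\times B)$ for all Borel $A,B$. Topological lens: $\widetilde T(\rho)(A\times B)=\rho(T^{-1}A\times T^{-1}B)$. ${\rm Aut}(\lambda)$ is identified with its image in $C_2(\lambda)$ under $S\mapsto\lambda_S$, $\lambda_S(A\times B)=\lambda(S^{-1}A\cap B)$; on this image $\widetilde T$ acts as conjugation $S\mapsto TST^{-1}$.
   Formalization: Systems are taken to be invertible: a homeomorphism in (1), and a measure-preserving map invertible mod 0 in (2); this is needed, since the lens map of the shift is invertible and, e.g., the doubling map of the circle cannot be isomorphic to a subsystem. *)

theory Defs
  imports "HOL-Probability.Probability"
begin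

text \<open>The circle T = R/Z is represented by the fundamental domain [0,1) with
  its Borel sigma-algebra and Lebesgue measure (Borel isomorphic to R/Z).\<close>

type_synonym pt = "int \<Rightarrow> real"

definition circ :: "real measure" where
  "circ = restrict_space lborel {0..<1}"

definition Ylam :: "pt measure" where
  "Ylam = (\<Pi>\<^sub>M i\<in>(UNIV::int set). circ)"

definition shiftT :: "pt \<Rightarrow> pt" where
  "shiftT y = (\<lambda>n. y (n + 1))"

definition measure_preserving :: "'a measure \<Rightarrow> 'b measure \<Rightarrow> ('a \<Rightarrow> 'b) set" where
  "measure_preserving M N = {f. f \<in> M \<rightarrow>\<^sub>M N \<and> (\<forall>A\<in>sets N. emeasure M (f -` A \<inter> space M) = emeasure N A)}"

definition Aut :: "'a measure \<Rightarrow> ('a \<Rightarrow> 'a) set" where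
  "Aut M = {S. S \<in> measure_preserving M M \<and>
     (\<exists>S'. S' \<in> measure_preserving M M \<and> (AE x in M. S' (S x) = x) \<and> (AE x in M. S (S' x) = x))}"

definition C2 :: "(pt \<times> pt) measure set" where
  "C2 = {\<rho>. space \<rho> = space (Ylam \<Otimes>\<^sub>M Ylam) \<and> sets \<rho> = sets (Ylam \<Otimes>\<^sub>M Ylam)
            \<and> prob_space \<rho> \<and> distr \<rho> Ylam fst = Ylam \<and> distr \<rho> Ylam snd = Ylam}"

text \<open>Rectangle evaluation map; the topology of C_2 is the coarsest one making all
  maps rho |-> rho(A x B) (A, B Borel) continuous, i.e. rho_n -> rho iff
  rho_n(A x B) -> rho(A x B) for all Borel A, B.\<close>

definition rect_eval :: "(pt \<times> pt) measure \<Rightarrow> (pt set \<times> pt set) \<Rightarrow> real" where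
  "rect_eval \<rho> = (\<lambda>(A, B). if A \<in> sets Ylam \<and> B \<in> sets Ylam then measure \<rho> (A \<times> B) else 0)"

definition C2_top :: "(pt \<times> pt) measure topology" where
  "C2_top = pullback_topology C2 rect_eval euclidean"

definition C2_borel :: "(pt \<times> pt) measure set set" where
  "C2_borel = sigma_sets C2 {U. openin C2_top U}"

definition lensT :: "(pt \<Rightarrow> pt) \<Rightarrow> (pt \<times> pt) measure \<Rightarrow> (pt \<times> pt) measure" where
  "lensT T \<rho> = distr \<rho> (Ylam \<Otimes>\<^sub>M Ylam) (\<lambda>(x, y). (T x, T y))"

definition graph_coupling :: "(pt \<Rightarrow> pt) \<Rightarrow> (pt \<times> pt) measure" where
  "graph_coupling S = distr Ylam (Ylam \<Otimes>\<^sub>M Ylam) (\<lambda>y. (S y, y))"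

definition AutC2 :: "(pt \<times> pt) measure set" where
  "AutC2 = graph_coupling ` Aut Ylam"

text \<open>Invertible topological system (K, f) with inverse g; topological transitivity:
  for nonempty open U, V there is n \<in> Z with f^n U \<inter> V \<noteq> {}.\<close>
definition top_transitive :: "'x::topological_space set \<Rightarrow> ('x \<Rightarrow> 'x) \<Rightarrow> ('x \<Rightarrow> 'x) \<Rightarrow> bool" where
  "top_transitive K f g \<longleftrightarrow>
     (\<forall>U V. openin (top_of_set K) U \<and> openin (top_of_set K) V \<and> U \<noteq> {} \<and> V \<noteq> {} \<longrightarrow>
        (\<exists>n. (f ^^ n) ` U \<inter> V \<noteq> {} \<or> (g ^^ n) ` U \<inter> V \<noteq> {}))"

definition ergodic :: "'a measure \<Rightarrow> ('a \<Rightarrow> 'a) \<Rightarrow> bool" where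
  "ergodic M S \<longleftrightarrow> (\<forall>A\<in>sets M. S -` A \<inter> space M = A \<longrightarrow> measure M A = 0 \<or> measure M A = 1)"

definition standard_borel :: "'a measure \<Rightarrow> bool" where
  "standard_borel M \<longleftrightarrow> (\<exists>X::'a topology. topspace X = space M \<and> completely_metrizable_space X
       \<and> separable_space X \<and> sets M = sigma_sets (space M) {U. openin X U})"

definition standard_prob_space :: "'a measure \<Rightarrow> bool" where
  "standard_prob_space M \<longleftrightarrow> prob_space M \<and> standard_borel M"

definition mp_isomorphic :: "'a measure \<Rightarrow> ('a \<Rightarrow> 'a) \<Rightarrow> 'b measure \<Rightarrow> ('b \<Rightarrow> 'b) \<Rightarrow> bool" where
  "mp_isomorphic M S N R \<longleftrightarrow> (\<exists>\<phi> \<psi>. \<phi> \<in> measure_preserving M N \<and> \<psi> \<in> measure_preserving N M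
      \<and> (AE x in M. \<psi> (\<phi> x) = x) \<and> (AE y in N. \<phi> (\<psi> y) = y)
      \<and> (AE x in M. \<phi> (S x) = R (\<phi> x)))"

end

theory Submission
  imports Defs
begin

text \<open>Both embeddings come from one family of automorphisms. For \<open>w : \<int> \<times> \<nat> \<rightarrow> [0, 1/2]\<close> let \<open>S\<^sub>w\<close> act on the
  \<open>n\<close>-th coordinate by rotating the \<open>j\<close>-th piece of a fixed partition of the circle into countably many
  intervals by the proportion \<open>w n j\<close> of its length. Then \<open>w \<mapsto> S\<^sub>w\<close> is a topological embedding of the
  compact parameter space into \<open>C\<^sub>2(\<lambda>)\<close> and conjugation by the shift shifts \<open>w\<close>. A compact system
  \<open>(K, f)\<close> is embedded by \<open>w n j = u\<^sub>j(f\<^sup>n x)\<close> with functions \<open>u\<^sub>j\<close> separating points, and a measure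
  preserving system by taking for \<open>u\<^sub>j\<close> the binary digits of a Borel embedding into Cantor space.

  Density of the graph couplings: given finitely many sets, the law of the atoms of the partition they
  generate under a coupling is realized exactly by an automorphism, because atomless standard
  probability spaces are isomorphic by an isomorphism respecting any prescribed countable partitions
  of equal law. A coupling is a graph of an automorphism iff each set of a countable generating
  family is approximated, in either direction, by sets depending on the other coordinate only; this
  is a \<open>G\<^sub>\<delta>\<close> condition.\<close>

section \<open>Borel retracts of Cantor space\<close>

text \<open>Each coordinate map has to store a whole point of the system, that is countably many
  reals, while one rotation stores one angle; hence the countably many pieces. Since angles 0 and 1
  give the same rotation, the bound 1/2 is imposed so that two admissible angles never differ by a
  nonzero integer. A rotated piece jumps at its cut, but for a given limit angle the bad points are
  countable, so the automorphism depends continuously on the parameter almost everywhere; this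
  suffices because the topology of \<open>C2\<close> sees only measures of rectangles. With compact
  parameters and a Hausdorff target, continuity and injectivity already give the embedding. The same
  compactness makes images of closed parameter sets closed and so makes the inverse Borel, which the
  measure-theoretic half requires. The classification of standard Borel spaces is bypassed: a Borel
  map into Cantor space with a Borel left inverse is enough, because isomorphisms are required only
  almost everywhere.\<close>

definition cantor :: "(nat \<Rightarrow> bool) measure" where
  "cantor = (\<Pi>\<^sub>M i\<in>(UNIV::nat set). count_space UNIV)"

text \<open>A one-sided form of being standard: \<open>R\<close> makes \<open>E\<close> injective
  and measurably invertible on its range, without asking that the range be a Borel set.\<close>

definition cantor_retract :: "'a measure \<Rightarrow> bool" where
  "cantor_retract M \<longleftrightarrow> (\<exists>E R. E \<in> M \<rightarrow>\<^sub>M cantor \<and> R \<in> cantor \<rightarrow>\<^sub>M M \<and> (\<forall>x\<in>space M. R (E x) = x))"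

lemma space_cantor [simp]: "space cantor = UNIV"
  by (simp add: cantor_def space_PiM)

lemma measurable_cantor_component: "Measurable.pred cantor (\<lambda>d. d n)"
  unfolding cantor_def by measurable

lemma measurable_into_cantor:
  assumes "\<And>n. Measurable.pred M (\<lambda>x. f x n)"
  shows "f \<in> M \<rightarrow>\<^sub>M cantor"
  unfolding cantor_def by (rule measurable_PiM_single') (use assms in auto)

lemma cantor_retract_of_retract:
  assumes "cantor_retract N" and f: "f \<in> M \<rightarrow>\<^sub>M N" and g: "g \<in> N \<rightarrow>\<^sub>M M"
    and gf: "\<And>x. x \<in> space M \<Longrightarrow> g (f x) = x"
  shows "cantor_retract M"
proof -
  obtain E R where ER: "E \<in> N \<rightarrow>\<^sub>M cantor" "R \<in> cantor \<rightarrow>\<^sub>M N" "\<forall>x\<in>space N. R (E x) = x"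
    using assms unfolding cantor_retract_def by blast
  show ?thesis unfolding cantor_retract_def
  proof (intro exI conjI ballI)
    show "(\<lambda>x. E (f x)) \<in> M \<rightarrow>\<^sub>M cantor" using f ER by measurable
    show "(\<lambda>x. g (R x)) \<in> cantor \<rightarrow>\<^sub>M M" using g ER by measurable
  qed (use ER gf measurable_space[OF f] in auto)
qed

text \<open>A point of a Polish space is recorded by the set of balls \<open>B(c\<^sub>j, 2\<^sup>-\<^sup>n)\<close> around the points of a
  dense sequence that contain it; it is the limit of the centres of the first such balls.\<close>

lemma standard_borel_cantor_retract:
  assumes "standard_borel M" and "space M \<noteq> {}"
  shows "cantor_retract M"
proof -
  obtain X where X: "topspace X = space M" "completely_metrizable_space X" "separable_space X"
    and sM: "sets M = sigma_sets (space M) {U. openin X U}"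
    using assms unfolding standard_borel_def by blast
  obtain \<Omega> d where "Metric_space \<Omega> d" and mc: "Metric_space.mcomplete \<Omega> d"
    and Xd: "X = Metric_space.mtopology \<Omega> d"
    using X(2) unfolding completely_metrizable_space_def by blast
  interpret Metric_space \<Omega> d by fact
  have sp: "space M = \<Omega>" using X Xd by simp
  obtain C where C: "countable C" "C \<subseteq> \<Omega>" "mtopology closure_of C = \<Omega>"
    using X(3) unfolding separable_space_def Xd by auto
  have Cne: "C \<noteq> {}" using C(3) assms(2) sp by auto
  define c where "c = from_nat_into C"
  have c: "c j \<in> \<Omega>" for j using C Cne from_nat_into[OF Cne] c_def by blast
  have dense: "\<exists>j. x \<in> mball (c j) e" if xe: "x \<in> \<Omega>" "e > 0" for x e
  proof -
    have "x \<in> mtopology closure_of C" using xe C by simp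
    then obtain y where "y \<in> C" "y \<in> mball x e"
      using xe(2) unfolding metric_closure_of by blast
    moreover obtain j where "c j = y"
      using \<open>y \<in> C\<close> C(1) Cne c_def by (metis from_nat_into_surj)
    ultimately show ?thesis by (auto simp: commute)
  qed
  define E where "E x m = (case prod_decode m of (j, n) \<Rightarrow> x \<in> mball (c j) ((1/2)^n))" for x m
  \<comment> \<open>If no ball of radius \<open>(1/2)^n\<close> is marked in \<open>u\<close>,
    \<open>LEAST\<close> returns an unspecified index; the resulting centres are judged only by
    whether they converge.\<close>
  define k :: "nat \<Rightarrow> (nat \<Rightarrow> bool) \<Rightarrow> nat" where "k n u = (LEAST j. u (prod_encode (j, n)))" for n u
  define conv where "conv u \<longleftrightarrow> (\<exists>l. limitin mtopology (\<lambda>n. c (k n u)) l sequentially)" for u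
  \<comment> \<open>Sequences that code no point must still be sent into \<open>space M\<close>; the
    default is the centre \<open>c 0\<close>.\<close>
  define R where "R u = (if conv u then (THE l. limitin mtopology (\<lambda>n. c (k n u)) l sequentially) else c 0)" for u
  have R_lim: "R u = l" if "limitin mtopology (\<lambda>n. c (k n u)) l sequentially" for u l
    using that limitin_Hausdorff_unique[OF _ _ trivial_limit_sequentially Hausdorff_space_mtopology]
    unfolding R_def conv_def by (auto intro!: the_equality)
  have k [measurable]: "k n \<in> cantor \<rightarrow>\<^sub>M count_space UNIV" for n
    unfolding k_def using measurable_cantor_component by measurable
  have openM: "U \<in> sets M" if "openin mtopology U" for U
    using that unfolding sM Xd by (auto intro: sigma_sets.Basic)
  have E: "E \<in> M \<rightarrow>\<^sub>M cantor"
  proof (rule measurable_into_cantor)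
    fix m
    obtain j n where jn: "prod_decode m = (j, n)" by fastforce
    have "{x \<in> space M. E x m} = mball (c j) ((1/2)^n)" using jn by (auto simp: E_def sp)
    then show "Measurable.pred M (\<lambda>x. E x m)"
      using openM[OF openin_mball] by (simp add: pred_def)
  qed
  \<comment> \<open>Existence of a limit is not visibly a Borel condition. Completeness turns it
    into the Cauchy condition, where the radii \<open>(1/2)^i\<close> leave only countable
    quantifiers; naming the values \<open>a\<close>, \<open>b\<close> of \<open>k\<close> reduces
    the distance condition to countably many level sets.\<close>
  have conv_meas: "Measurable.pred cantor conv"
  proof -
    have "conv u \<longleftrightarrow> MCauchy (\<lambda>n. c (k n u))" for u
    proof
      show "conv u \<Longrightarrow> MCauchy (\<lambda>n. c (k n u))"
        unfolding conv_def using c by (auto intro: convergent_imp_MCauchy)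
      show "MCauchy (\<lambda>n. c (k n u)) \<Longrightarrow> conv u"
        using mc unfolding mcomplete_def conv_def by simp
    qed
    also have "\<dots> u \<longleftrightarrow> (\<forall>i. \<exists>N. \<forall>n m. N \<le> n \<longrightarrow> N \<le> m \<longrightarrow>
        (\<exists>a b. k n u = a \<and> k m u = b \<and> d (c a) (c b) < (1/2)^i))" for u
    proof
      assume L: "MCauchy (\<lambda>n. c (k n u))"
      show "\<forall>i. \<exists>N. \<forall>n m. N \<le> n \<longrightarrow> N \<le> m \<longrightarrow>
        (\<exists>a b. k n u = a \<and> k m u = b \<and> d (c a) (c b) < (1/2)^i)"
        using L unfolding MCauchy_def by simp
    next
      assume L: "\<forall>i. \<exists>N. \<forall>n m. N \<le> n \<longrightarrow> N \<le> m \<longrightarrow>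
        (\<exists>a b. k n u = a \<and> k m u = b \<and> d (c a) (c b) < (1/2)^i)"
      show "MCauchy (\<lambda>n. c (k n u))"
        unfolding MCauchy_def
      proof (intro conjI allI impI)
        fix e :: real assume "e > 0"
        then obtain i where "(1/2::real)^i < e" using real_arch_pow_inv[of e "1/2"] by auto
        then show "\<exists>N. \<forall>n n'. N \<le> n \<longrightarrow> N \<le> n' \<longrightarrow> d (c (k n u)) (c (k n' u)) < e"
          using L by (meson less_trans)
      qed (use c in auto)
    qed
    finally have *: "conv = (\<lambda>u. \<forall>i. \<exists>N. \<forall>n m. N \<le> n \<longrightarrow> N \<le> m \<longrightarrow>
        (\<exists>a b. k n u = a \<and> k m u = b \<and> d (c a) (c b) < (1/2)^i))" by auto
    show ?thesis unfolding * by measurable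
  qed
  have R_space: "R u \<in> \<Omega>" for u
    using R_lim[of u] c limitin_mspace unfolding R_def conv_def by (metis (full_types))
  have R: "R \<in> cantor \<rightarrow>\<^sub>M M"
  proof (rule measurable_sigma_sets[OF sM])
    show "{U. openin X U} \<subseteq> Pow (space M)" using X(1) openin_subset by fastforce
    show "R \<in> space cantor \<rightarrow> space M" using R_space sp by auto
    fix U assume "U \<in> {U. openin X U}"
    then have U: "openin mtopology U" using Xd by simp
    \<comment> \<open>One fixed radius detects an open set: if the limit lies in \<open>U\<close>,
      sufficiently small balls around all late centres stay in \<open>U\<close>; conversely, such a
      ball around a late centre contains the limit.\<close>
    have iff: "R u \<in> U \<longleftrightarrow> (\<exists>i N. \<forall>n\<ge>N. mball (c (k n u)) ((1/2)^i) \<subseteq> U)" if cu: "conv u" for u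
    proof -
      obtain l where l: "limitin mtopology (\<lambda>n. c (k n u)) l sequentially" using cu conv_def by auto
      have lR: "R u = l" and lO: "l \<in> \<Omega>" using R_lim l limitin_mspace by auto
      have ev: "\<exists>N. \<forall>n\<ge>N. d (c (k n u)) l < e" if "e > 0" for e
        using l that unfolding limit_metric_sequentially by blast
      show ?thesis
      proof
        assume "R u \<in> U"
        then obtain r where r: "r > 0" "mball l r \<subseteq> U"
          using U lR unfolding openin_mtopology by auto
        obtain i where i: "(1/2::real)^i < r/2" using real_arch_pow_inv[of "r/2" "1/2"] r by auto
        obtain N where N: "\<forall>n\<ge>N. d (c (k n u)) l < r/2" using ev[of "r/2"] r by auto
        have "mball (c (k n u)) ((1/2)^i) \<subseteq> U" if "n \<ge> N" for n
        proof
          fix y assume y: "y \<in> mball (c (k n u)) ((1/2)^i)"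
          then have "d l y \<le> d l (c (k n u)) + d (c (k n u)) y"
            using c lO by (intro triangle) auto
          also have "\<dots> < r/2 + r/2" using y i N that by (intro add_strict_mono) (auto simp: commute)
          finally show "y \<in> U" using r y lO by auto
        qed
        then show "\<exists>i N. \<forall>n\<ge>N. mball (c (k n u)) ((1/2)^i) \<subseteq> U" by blast
      next
        assume "\<exists>i N. \<forall>n\<ge>N. mball (c (k n u)) ((1/2)^i) \<subseteq> U"
        then obtain i N where iN: "\<forall>n\<ge>N. mball (c (k n u)) ((1/2)^i) \<subseteq> U" by blast
        obtain N' where N': "\<forall>n\<ge>N'. d (c (k n u)) l < (1/2)^i" using ev[of "(1/2)^i"] by auto
        have "l \<in> mball (c (k (max N N') u)) ((1/2)^i)" using N' lO c by auto
        then show "R u \<in> U" using iN lR by (meson max.cobounded1 subsetD)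
      qed
    qed
    have "R u = c 0" if "\<not> conv u" for u using that by (simp add: R_def)
    with iff have "R u \<in> U \<longleftrightarrow> (conv u \<and> (\<exists>i N. \<forall>n\<ge>N. mball (c (k n u)) ((1/2)^i) \<subseteq> U)) \<or> (\<not> conv u \<and> c 0 \<in> U)" for u
      by (cases "conv u") simp_all
    then have "R -` U \<inter> space cantor = {u \<in> space cantor. (conv u \<and> (\<exists>i N. \<forall>n. n \<ge> N \<longrightarrow> (\<exists>a. k n u = a \<and> mball (c a) ((1/2)^i) \<subseteq> U)))
         \<or> (\<not> conv u \<and> c 0 \<in> U)}"
      by auto
    also have "\<dots> \<in> sets cantor" using conv_meas by measurable
    finally show "R -` U \<inter> space cantor \<in> sets cantor" .
  qed
  have "R (E x) = x" if x: "x \<in> space M" for x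
  proof (rule R_lim)
    have dk: "d (c (k n (E x))) x < (1/2)^n" for n
    proof -
      have "\<exists>j. E x (prod_encode (j, n))" using dense[of x "(1/2)^n"] x sp by (auto simp: E_def)
      then have "E x (prod_encode (k n (E x), n))" unfolding k_def by (rule LeastI_ex)
      then show ?thesis by (auto simp: E_def)
    qed
    show "limitin mtopology (\<lambda>n. c (k n (E x))) x sequentially"
      unfolding limit_metric_sequentially
    proof (intro conjI allI impI)
      show "x \<in> \<Omega>" using x sp by simp
      fix e :: real assume "e > 0"
      then obtain N where N: "(1/2::real)^N < e" using real_arch_pow_inv[of e "1/2"] by auto
      have "d (c (k n (E x))) x < e" if "n \<ge> N" for n
        using dk[of n] N power_decreasing[OF that, of "1/2::real"] by linarith
      then show "\<exists>N. \<forall>n\<ge>N. c (k n (E x)) \<in> \<Omega> \<and> d (c (k n (E x))) x < e" using c by blast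
    qed
  qed
  then show ?thesis unfolding cantor_retract_def using E R by blast
qed

lemma standard_borel_borel:
  "standard_borel (borel :: 'a::{complete_space, second_countable_topology} measure)"
proof -
  have "completely_metrizable_space (euclidean :: 'a topology)"
    unfolding completely_metrizable_space_def
    using Met_TC.Metric_space_axioms mcomplete_iff_complete complete_UNIV
    by (metis mtopology_is_euclidean)
  moreover have "separable_space (euclidean :: 'a topology)"
  proof -
    obtain D :: "'a set" where D: "countable D" "\<And>X. open X \<Longrightarrow> X \<noteq> {} \<Longrightarrow> \<exists>d\<in>D. d \<in> X"
      using countable_dense_exists by blast
    have "closure D = UNIV"
    proof (rule ccontr)
      assume "closure D \<noteq> UNIV"
      then have "\<exists>d\<in>D. d \<in> - closure D" by (intro D) auto
      then show False using closure_subset[of D] by blast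
    qed
    then show ?thesis
      unfolding separable_space_def using D by auto
  qed
  ultimately show ?thesis
    unfolding standard_borel_def borel_def by (intro exI[of _ euclidean]) (auto simp: sets_measure_of_conv)
qed

section \<open>Isomorphisms of atomless standard probability spaces\<close>

text \<open>The almost everywhere inverse is carried along explicitly, so that inverting and
  composing isomorphisms is purely formal.\<close>

definition mp_iso :: "'a measure \<Rightarrow> 'b measure \<Rightarrow> ('a \<Rightarrow> 'b) \<Rightarrow> ('b \<Rightarrow> 'a) \<Rightarrow> bool" where
  "mp_iso M N f g \<longleftrightarrow> f \<in> measure_preserving M N \<and> g \<in> measure_preserving N M
     \<and> (AE x in M. g (f x) = x) \<and> (AE y in N. f (g y) = y)"

lemma measure_preserving_iff:
  "f \<in> measure_preserving M N \<longleftrightarrow> f \<in> M \<rightarrow>\<^sub>M N \<and> distr M N f = N"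
proof
  assume f: "f \<in> measure_preserving M N"
  then have "f \<in> M \<rightarrow>\<^sub>M N" by (simp add: measure_preserving_def)
  moreover from this have "distr M N f = N"
    using f by (intro measure_eqI) (auto simp: emeasure_distr measure_preserving_def)
  ultimately show "f \<in> M \<rightarrow>\<^sub>M N \<and> distr M N f = N" ..
next
  assume f: "f \<in> M \<rightarrow>\<^sub>M N \<and> distr M N f = N"
  show "f \<in> measure_preserving M N"
    unfolding measure_preserving_def using f emeasure_distr[of f M N] by auto
qed

lemma measure_preserving_measurable: "f \<in> measure_preserving M N \<Longrightarrow> f \<in> M \<rightarrow>\<^sub>M N"
  by (simp add: measure_preserving_iff)

lemma measure_preserving_distr: "f \<in> measure_preserving M N \<Longrightarrow> distr M N f = N"
  by (simp add: measure_preserving_iff)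

lemma measure_preserving_comp:
  "f \<in> measure_preserving M N \<Longrightarrow> g \<in> measure_preserving N L \<Longrightarrow> (\<lambda>x. g (f x)) \<in> measure_preserving M L"
  using distr_distr[of g N L f M] by (auto simp: measure_preserving_iff comp_def)

text \<open>\<open>P\<close> may be non-measurable: its failures are covered by a null set, whose
  preimage is null.\<close>

lemma AE_measure_preserving:
  assumes "f \<in> measure_preserving M N" "AE y in N. P y"
  shows "AE x in M. P (f x)"
proof -
  have "f \<in> M \<rightarrow>\<^sub>M N" "distr M N f = N" using assms by (auto simp: measure_preserving_iff)
  then show ?thesis using AE_distrD[of f M N P] assms by metis
qed

lemma measure_preserving_cong_AE:
  assumes f: "f \<in> measure_preserving M N" and g: "g \<in> M \<rightarrow>\<^sub>M N" and eq: "AE x in M. f x = g x"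
  shows "g \<in> measure_preserving M N"
proof -
  have "distr M N g = distr M N f"
    using eq f g by (intro distr_cong_AE) (auto simp: measure_preserving_iff)
  then show ?thesis using f g by (simp add: measure_preserving_iff)
qed

lemma mp_iso_sym: "mp_iso M N f g \<Longrightarrow> mp_iso N M g f"
  by (auto simp: mp_iso_def)

lemma mp_iso_comp:
  assumes "mp_iso M N f g" "mp_iso N L f' g'"
  shows "mp_iso M L (\<lambda>x. f' (f x)) (\<lambda>x. g (g' x))"
proof -
  have "AE x in M. g' (f' (f x)) = f x" "AE x in L. f (g (g' x)) = g' x"
    using assms AE_measure_preserving[of f M N "\<lambda>y. g' (f' y) = y"]
      AE_measure_preserving[of g' L N "\<lambda>y. f (g y) = y"] by (simp_all add: mp_iso_def)
  moreover have "AE x in M. g (f x) = x" "AE x in L. f' (g' x) = x"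
    using assms by (auto simp: mp_iso_def)
  ultimately have "AE x in M. g (g' (f' (f x))) = x" "AE x in L. f' (f (g (g' x))) = x"
    by auto
  then show ?thesis using assms by (auto simp: mp_iso_def intro: measure_preserving_comp)
qed

lemma Aut_iff_mp_iso: "S \<in> Aut M \<longleftrightarrow> (\<exists>S'. mp_iso M M S S')"
  by (auto simp: Aut_def mp_iso_def)

section \<open>Distribution functions as isomorphisms onto Lebesgue measure on the unit
  interval\<close>

definition uniform01 :: "real measure" where
  "uniform01 = distr (restrict_space lborel {0<..<1}) borel (\<lambda>x. x)"

lemma AE_uniform01: "AE u in uniform01. 0 < u \<and> u < 1"
proof -
  have [measurable]: "(\<lambda>x. x) \<in> restrict_space lborel {0<..<1::real} \<rightarrow>\<^sub>M borel"
    by (rule measurable_restrict_space1) simp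
  have "AE u in restrict_space lborel {0<..<1::real}. 0 < u \<and> u < 1"
    by (rule AE_I2) (auto simp: space_restrict_space)
  then show ?thesis
    unfolding uniform01_def by (subst AE_distr_iff) auto
qed

text \<open>The generalized inverse of the distribution function. Outside the open unit interval the
  infimum may be over an empty or unbounded set, so 0 is substituted there, on a null set of
  \<open>uniform01\<close>.\<close>

definition quantile :: "real measure \<Rightarrow> real \<Rightarrow> real" where
  "quantile \<mu> u = (if 0 < u \<and> u < 1 then Inf {x. u \<le> cdf \<mu> x} else 0)"

lemma quantile_le_iff:
  assumes "real_distribution \<mu>" "0 < u" "u < 1"
  shows "quantile \<mu> u \<le> x \<longleftrightarrow> u \<le> cdf \<mu> x"
proof -
  interpret cdf_distribution \<mu> by (simp add: cdf_distribution_def assms)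
  show ?thesis using pseudoinverse[of u x] assms by (simp add: quantile_def)
qed

text \<open>Without atoms \<open>cdf\<close> is continuous. Strictly to the left of the quantile it
  stays below \<open>u\<close>, so its left limit, which is its value at the quantile, is at most
  \<open>u\<close>.\<close>

lemma cdf_quantile:
  assumes "real_distribution \<mu>" and atomless: "\<And>x. measure \<mu> {x} = 0" and u: "0 < u" "u < 1"
  shows "cdf \<mu> (quantile \<mu> u) = u"
proof (rule antisym)
  interpret cdf_distribution \<mu> by (simp add: cdf_distribution_def assms)
  show "u \<le> cdf \<mu> (quantile \<mu> u)"
    using quantile_le_iff[of \<mu> u "quantile \<mu> u"] assms by simp
  have "isCont (cdf \<mu>) (quantile \<mu> u)" using atomless isCont_cdf by simp
  then have "(cdf \<mu> \<longlongrightarrow> cdf \<mu> (quantile \<mu> u)) (at_left (quantile \<mu> u))"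
    unfolding isCont_def by (simp add: filterlim_at_split)
  moreover have "cdf \<mu> x \<le> u" if "x < quantile \<mu> u" for x
    using quantile_le_iff[of \<mu> u x] that assms by auto
  then have "\<forall>\<^sub>F x in at_left (quantile \<mu> u). cdf \<mu> x \<le> u"
    by (auto simp: eventually_at_filter)
  ultimately show "cdf \<mu> (quantile \<mu> u) \<le> u"
    using tendsto_upperbound trivial_limit_at_left_real by blast
qed

lemma mp_iso_cdf_quantile:
  assumes \<mu>: "real_distribution \<mu>" and atomless: "\<And>x. measure \<mu> {x} = 0"
  shows "mp_iso \<mu> uniform01 (cdf \<mu>) (quantile \<mu>)"
proof -
  interpret cdf_distribution \<mu> by (simp add: cdf_distribution_def assms)
  have id[measurable]: "(\<lambda>x. x) \<in> restrict_space lborel {0<..<1::real} \<rightarrow>\<^sub>M borel"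
    by (rule measurable_restrict_space1) simp
  have [simp]: "sets uniform01 = sets borel" by (simp add: uniform01_def)
  have [measurable_cong]: "sets \<mu> = sets borel" "sets uniform01 = sets borel" by simp_all
  have [simp]: "measurable uniform01 L = measurable borel L" "measurable \<mu> L = measurable borel L" for L :: "real measure"
    by (simp_all cong: measurable_cong_sets)
  have [measurable]: "cdf \<mu> \<in> borel_measurable borel" by (rule measurable_C)
  have [measurable]: "quantile \<mu> \<in> borel_measurable borel"
  proof -
    have "(\<lambda>x. if x \<in> {0<..<1} then I x else 0) \<in> borel_measurable borel"
      using measurable_CI by (subst (asm) measurable_restrict_space_iff[where c=0]) auto
    also have "(\<lambda>x. if x \<in> {0<..<1} then I x else 0) = quantile \<mu>"
      by (auto simp: quantile_def)
    finally show ?thesis .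
  qed
  have "distr uniform01 borel (quantile \<mu>) = distr (restrict_space lborel {0<..<1}) borel (quantile \<mu>)"
    unfolding uniform01_def by (subst distr_distr) (auto simp: comp_def)
  also have "\<dots> = distr (restrict_space lborel {0<..<1}) borel I"
    by (intro distr_cong) (auto simp: space_restrict_space quantile_def)
  finally have Q: "distr uniform01 borel (quantile \<mu>) = \<mu>" using distr_I_eq_M by simp
  have FQ: "AE u in uniform01. cdf \<mu> (quantile \<mu> u) = u"
    using AE_uniform01 by eventually_elim (use cdf_quantile assms in auto)
  have "distr \<mu> borel (cdf \<mu>) = distr (distr uniform01 borel (quantile \<mu>)) borel (cdf \<mu>)" using Q by simp
  also have "\<dots> = distr uniform01 borel (\<lambda>u. cdf \<mu> (quantile \<mu> u))"
    by (subst distr_distr) (auto simp: comp_def)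
  also have "\<dots> = distr uniform01 borel (\<lambda>u. u)"
    using FQ by (intro distr_cong_AE) auto
  also have "\<dots> = uniform01"
    by (rule distr_id2) simp
  finally have F: "distr \<mu> borel (cdf \<mu>) = uniform01" .
  \<comment> \<open>Almost every point of \<open>\<mu>\<close> is \<open>quantile \<mu> u\<close>
    for some \<open>u\<close> with \<open>cdf \<mu> (quantile \<mu> u) = u\<close>, and at such a
    point the claim is immediate.\<close>
  have "AE x in distr uniform01 borel (quantile \<mu>). quantile \<mu> (cdf \<mu> x) = x"
    using FQ by (subst AE_distr_iff) auto
  then have "AE x in \<mu>. quantile \<mu> (cdf \<mu> x) = x" unfolding Q .
  moreover have "distr \<mu> uniform01 (cdf \<mu>) = uniform01"
    using distr_cong[of \<mu> \<mu> uniform01 borel "cdf \<mu>" "cdf \<mu>"] F by simp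
  moreover have "distr uniform01 \<mu> (quantile \<mu>) = \<mu>"
    using distr_cong[of uniform01 uniform01 \<mu> borel "quantile \<mu>" "quantile \<mu>"] Q by simp
  ultimately show ?thesis
    unfolding mp_iso_def measure_preserving_iff using FQ
    by (simp add: measurable_cong_sets[of borel borel uniform01 borel] measurable_cong_sets[of borel borel \<mu> borel])
qed

text \<open>Monotone rearrangement between atomless distributions respects every level at which the
  distribution functions agree.\<close>

lemma mp_iso_monotone_rearrangement:
  assumes \<mu>: "real_distribution \<mu>" "\<And>x. measure \<mu> {x} = 0"
    and \<nu>: "real_distribution \<nu>" "\<And>x. measure \<nu> {x} = 0"
  shows "mp_iso \<mu> \<nu> (\<lambda>x. quantile \<nu> (cdf \<mu> x)) (\<lambda>x. quantile \<mu> (cdf \<nu> x))"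
    and "AE x in \<mu>. \<forall>c. cdf \<mu> c = cdf \<nu> c \<longrightarrow> (x \<le> c \<longleftrightarrow> quantile \<nu> (cdf \<mu> x) \<le> c)"
proof -
  note iso = mp_iso_cdf_quantile[OF \<mu>] mp_iso_cdf_quantile[OF \<nu>]
  show "mp_iso \<mu> \<nu> (\<lambda>x. quantile \<nu> (cdf \<mu> x)) (\<lambda>x. quantile \<mu> (cdf \<nu> x))"
    by (rule mp_iso_comp[OF iso(1) mp_iso_sym[OF iso(2)]])
  have "AE x in \<mu>. 0 < cdf \<mu> x \<and> cdf \<mu> x < 1"
    using AE_measure_preserving[OF _ AE_uniform01] iso(1) unfolding mp_iso_def by blast
  moreover have "AE x in \<mu>. quantile \<mu> (cdf \<mu> x) = x" using iso(1) by (simp add: mp_iso_def)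
  \<comment> \<open>For such \<open>x\<close> the adjunction \<open>quantile_le_iff\<close>, applied
    to \<open>\<mu>\<close> and to \<open>\<nu>\<close>, turns both inequalities into
    \<open>cdf \<mu> x\<close> being at most the common value at \<open>c\<close>. The exceptional
    set does not depend on \<open>c\<close>, so all levels are treated at once.\<close>
  ultimately show "AE x in \<mu>. \<forall>c. cdf \<mu> c = cdf \<nu> c \<longrightarrow> (x \<le> c \<longleftrightarrow> quantile \<nu> (cdf \<mu> x) \<le> c)"
  proof eventually_elim
    case (elim x)
    then show ?case
      using quantile_le_iff[OF \<mu>(1), of "cdf \<mu> x"] quantile_le_iff[OF \<nu>(1), of "cdf \<mu> x"] by auto
  qed
qed

text \<open>The point of the middle-thirds set with ternary digits 0 and 2. Unlike binary
  expansions, these codes are injective, and a gap separates the two possible leading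
  digits.\<close>

definition ternary_code :: "(nat \<Rightarrow> bool) \<Rightarrow> real" where
  "ternary_code d = (\<Sum>n. of_bool (d n) * (2 / 3 ^ Suc n))"

definition ternary_step :: "real \<Rightarrow> real" where
  "ternary_step z = (if z \<ge> 1/2 then 3 * z - 2 else 3 * z)"

definition ternary_digits :: "real \<Rightarrow> nat \<Rightarrow> bool" where
  "ternary_digits z n \<longleftrightarrow> (ternary_step ^^ n) z \<ge> 1/2"

lemma ternary_sums: "(\<lambda>n. 2 / 3 ^ Suc n) sums (1::real)"
  using sums_mult[OF geometric_sums[of "1/3::real"], of "2/3"] by (simp add: power_one_over field_simps)

lemma ternary_summable: "summable (\<lambda>n. of_bool (d n) * (2 / 3 ^ Suc n) :: real)"
  by (rule summable_comparison_test[OF _ sums_summable[OF ternary_sums]]) (auto simp: of_bool_def)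

lemma ternary_code_bounds: "0 \<le> ternary_code d" "ternary_code d \<le> 1"
proof -
  show "0 \<le> ternary_code d" unfolding ternary_code_def by (rule suminf_nonneg[OF ternary_summable]) auto
  have "ternary_code d \<le> (\<Sum>n. 2 / 3 ^ Suc n)"
    unfolding ternary_code_def
    by (rule suminf_le[OF _ ternary_summable sums_summable[OF ternary_sums]]) (auto simp: of_bool_def)
  then show "ternary_code d \<le> 1" using sums_unique[OF ternary_sums] by simp
qed

lemma ternary_code_split:
  "ternary_code d = of_bool (d 0) * (2/3) + ternary_code (\<lambda>n. d (Suc n)) / 3"
proof -
  have "ternary_code (\<lambda>n. d (Suc n)) / 3 = (\<Sum>n. of_bool (d (Suc n)) * (2 / 3 ^ Suc n) / 3)"
    unfolding ternary_code_def by (rule suminf_divide[OF ternary_summable, symmetric])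
  also have "\<dots> = (\<Sum>n. of_bool (d (Suc n)) * (2 / 3 ^ Suc (Suc n)))"
    by (intro suminf_cong) simp
  also have "\<dots> = ternary_code d - of_bool (d 0) * (2/3)"
    using suminf_split_head[OF ternary_summable[of d]] unfolding ternary_code_def by simp
  finally show ?thesis by argo
qed

lemma ternary_digits_code: "ternary_digits (ternary_code d) = d"
proof
  fix n
  \<comment> \<open>The tail lies in [0,1], so a code lies in [0,1/3] or in [2/3,1] according to its
    leading digit; 1/2 falls in the gap.\<close>
  have *: "ternary_code e \<ge> 1/2 \<longleftrightarrow> e 0" "ternary_step (ternary_code e) = ternary_code (\<lambda>n. e (Suc n))" for e
    using ternary_code_bounds[of "\<lambda>n. e (Suc n)"] ternary_code_split[of e]
    by (auto simp: ternary_step_def of_bool_def split: if_splits)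
  have "(ternary_step ^^ n) (ternary_code d) = ternary_code (\<lambda>i. d (n + i))" 
    by (induction n) (simp_all add: *)
  then show "ternary_digits (ternary_code d) n = d n"
    using *(1)[of "\<lambda>i. d (n + i)"] by (simp add: ternary_digits_def)
qed

lemma measurable_ternary_code [measurable]: "ternary_code \<in> borel_measurable cantor"
proof -
  have "(\<lambda>d. of_bool (d n) :: real) \<in> borel_measurable cantor" for n
    unfolding of_bool_def using measurable_cantor_component by measurable
  then show ?thesis unfolding ternary_code_def[abs_def]
    by (intro borel_measurable_suminf borel_measurable_times) auto
qed

lemma measurable_ternary_digits [measurable]: "ternary_digits \<in> borel \<rightarrow>\<^sub>M cantor"
proof (rule measurable_into_cantor)
  fix n
  have [measurable]: "ternary_step \<in> borel_measurable borel" unfolding ternary_step_def by measurable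
  have [measurable]: "(ternary_step ^^ n) \<in> borel_measurable borel"
    by (induction n) (auto intro: measurable_comp)
  show "Measurable.pred borel (\<lambda>x. ternary_digits x n)"
    unfolding ternary_digits_def by measurable
qed

text \<open>Moves the measure to the line. The left inverse \<open>r\<close> provides the inverse
  isomorphism, so nothing has to be known about the range of \<open>z\<close>.\<close>

lemma mp_iso_distr_real:
  fixes z :: "'a \<Rightarrow> real"
  assumes [measurable]: "z \<in> borel_measurable M" "r \<in> borel \<rightarrow>\<^sub>M M" and rz: "\<And>x. x \<in> space M \<Longrightarrow> r (z x) = x"
  shows "mp_iso M (distr M borel z) z r"
proof -
  have 1: "AE y in distr M borel z. z (r y) = y"
    by (subst AE_distr_iff) (auto simp: rz)
  have "distr (distr M borel z) M r = distr M M (\<lambda>x. r (z x))"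
    by (subst distr_distr) (auto simp: comp_def)
  also have "\<dots> = distr M M (\<lambda>x. x)" by (intro distr_cong) (auto simp: rz)
  finally have 2: "distr (distr M borel z) M r = M" by simp
  have 3: "distr M (distr M borel z) z = distr M borel z" by (intro distr_cong) auto
  show ?thesis unfolding mp_iso_def measure_preserving_iff using 1 2 3 by (auto simp: rz)
qed

text \<open>Both spaces are coded by reals in such a way that the cells of each partition follow one
  another in increasing order. Equal laws of \<open>p1\<close> and \<open>p2\<close> make the two
  distribution functions agree at the thresholds between cells, and monotone rearrangement respects
  those thresholds.\<close>

lemma mp_iso_atomless:
  fixes p1 :: "'a \<Rightarrow> nat" and p2 :: "'b \<Rightarrow> nat"
  assumes "prob_space M" "prob_space N" and "cantor_retract M" "cantor_retract N"
    and M0: "\<And>x. x \<in> space M \<Longrightarrow> emeasure M {x} = 0"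
    and N0: "\<And>x. x \<in> space N \<Longrightarrow> emeasure N {x} = 0"
    and p[measurable]: "p1 \<in> M \<rightarrow>\<^sub>M count_space UNIV" "p2 \<in> N \<rightarrow>\<^sub>M count_space UNIV"
    and law: "distr M (count_space UNIV) p1 = distr N (count_space UNIV) p2"
  shows "\<exists>f g. mp_iso M N f g \<and> (AE x in M. p2 (f x) = p1 x)"
proof -
  interpret M: prob_space M by fact
  interpret N: prob_space N by fact
  have code: "\<exists>z r. z \<in> borel_measurable L \<and> r \<in> borel \<rightarrow>\<^sub>M L \<and> (\<forall>x\<in>space L. r (z x) = x)
      \<and> (\<forall>x k. p x \<le> k \<longleftrightarrow> z x \<le> 2 * real k + 3/2)"
    if L: "cantor_retract L" and [measurable]: "p \<in> L \<rightarrow>\<^sub>M count_space UNIV" for L :: "'c measure" and p :: "'c \<Rightarrow> nat"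
  proof -
    obtain E R where ER[measurable]: "E \<in> L \<rightarrow>\<^sub>M cantor" "R \<in> cantor \<rightarrow>\<^sub>M L" and RE: "\<forall>x\<in>space L. R (E x) = x"
      using L unfolding cantor_retract_def by blast
    \<comment> \<open>Cell \<open>k\<close> occupies [2k, 2k+1]. The factor 2 leaves a gap before
      the next cell, with the threshold \<open>2 * real k + 3/2\<close> in its middle, and lets
      \<open>\<lfloor>z x / 2\<rfloor>\<close> recover the cell.\<close>
    define z where "z x = 2 * real (p x) + ternary_code (E x)" for x
    define r where "r t = R (ternary_digits (t - 2 * of_int \<lfloor>t / 2\<rfloor>))" for t
    have fl: "\<lfloor>z x / 2\<rfloor> = int (p x)" for x
      using ternary_code_bounds[of "E x"] unfolding z_def by (intro floor_unique) auto
    have "r (z x) = x" if "x \<in> space L" for x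
      unfolding r_def fl using RE that by (simp add: z_def ternary_digits_code)
    moreover have "p x \<le> k \<longleftrightarrow> z x \<le> 2 * real k + 3/2" for x k
    proof
      show "p x \<le> k \<Longrightarrow> z x \<le> 2 * real k + 3/2"
        using ternary_code_bounds[of "E x"] unfolding z_def by (simp add: add_mono)
      assume "z x \<le> 2 * real k + 3/2"
      then have "real (p x) < real k + 1" using ternary_code_bounds[of "E x"] unfolding z_def by linarith
      then show "p x \<le> k" by linarith
    qed
    moreover have "z \<in> borel_measurable L" unfolding z_def by measurable
    moreover have "r \<in> borel \<rightarrow>\<^sub>M L" unfolding r_def by measurable
    ultimately show ?thesis by blast
  qed
  obtain z1 r1 where z1[measurable]: "z1 \<in> borel_measurable M" "r1 \<in> borel \<rightarrow>\<^sub>M M"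
    and rz1: "\<And>x. x \<in> space M \<Longrightarrow> r1 (z1 x) = x" and pz1: "\<And>x k. p1 x \<le> k \<longleftrightarrow> z1 x \<le> 2 * real k + 3/2"
    using code[OF \<open>cantor_retract M\<close> p(1)] by blast
  obtain z2 r2 where z2[measurable]: "z2 \<in> borel_measurable N" "r2 \<in> borel \<rightarrow>\<^sub>M N"
    and rz2: "\<And>x. x \<in> space N \<Longrightarrow> r2 (z2 x) = x" and pz2: "\<And>x k. p2 x \<le> k \<longleftrightarrow> z2 x \<le> 2 * real k + 3/2"
    using code[OF \<open>cantor_retract N\<close> p(2)] by blast
  define \<mu> where "\<mu> = distr M borel z1"
  define \<nu> where "\<nu> = distr N borel z2"
  have \<mu>: "real_distribution \<mu>" unfolding \<mu>_def by (intro M.real_distribution_distr) auto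
  have \<nu>: "real_distribution \<nu>" unfolding \<nu>_def by (intro N.real_distribution_distr) auto
  \<comment> \<open>A left inverse leaves at most the single point \<open>r t\<close> in the fibre
    over \<open>t\<close>, so the image law inherits the absence of atoms.\<close>
  have at: "measure (distr L borel z) {t} = 0"
    if [measurable]: "z \<in> borel_measurable L" and rz: "\<And>x. x \<in> space L \<Longrightarrow> r (z x) = x" and "\<And>x. x \<in> space L \<Longrightarrow> emeasure L {x} = 0"
    for L :: "'c measure" and z :: "'c \<Rightarrow> real" and r t
  proof -
    have "z -` {t} \<inter> space L \<subseteq> {x \<in> {r t}. x \<in> space L}" using rz by auto
    then have "z -` {t} \<inter> space L = {} \<or> (z -` {t} \<inter> space L = {r t} \<and> r t \<in> space L)" by auto
    then have "measure L (z -` {t} \<inter> space L) = 0" using that(3)[of "r t"] by (auto simp: measure_def)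
    then show ?thesis using measure_distr[OF that(1), of "{t}"] by simp
  qed
  have \<mu>0: "measure \<mu> {t} = 0" for t unfolding \<mu>_def using at[OF z1(1) rz1 M0] .
  have \<nu>0: "measure \<nu> {t} = 0" for t unfolding \<nu>_def using at[OF z2(1) rz2 N0] .
  have iso1: "mp_iso M \<mu> z1 r1" unfolding \<mu>_def by (rule mp_iso_distr_real) (use rz1 in auto)
  have iso2: "mp_iso N \<nu> z2 r2" unfolding \<nu>_def by (rule mp_iso_distr_real) (use rz2 in auto)
  define g where "g x = quantile \<nu> (cdf \<mu> x)" for x
  note iso = mp_iso_monotone_rearrangement[OF \<mu> \<mu>0 \<nu> \<nu>0, folded g_def]
  have cdf_eq: "cdf \<mu> (2 * real k + 3/2) = cdf \<nu> (2 * real k + 3/2)" for k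
  proof -
    have "cdf \<mu> (2 * real k + 3/2) = measure M {x\<in>space M. p1 x \<le> k}"
      unfolding cdf_def \<mu>_def pz1 by (subst measure_distr) (auto intro!: arg_cong[where f="measure M"])
    also have "\<dots> = measure (distr M (count_space UNIV) p1) {..k}"
      by (subst measure_distr) (auto intro!: arg_cong[where f="measure M"])
    also have "\<dots> = measure N {x\<in>space N. p2 x \<le> k}"
      unfolding law by (subst measure_distr) (auto intro!: arg_cong[where f="measure N"])
    also have "\<dots> = cdf \<nu> (2 * real k + 3/2)"
      unfolding cdf_def \<nu>_def pz2 by (subst measure_distr) (auto intro!: arg_cong[where f="measure N"])
    finally show ?thesis .
  qed
  have t: "mp_iso M N (\<lambda>x. r2 (g (z1 x))) (\<lambda>y. r1 (quantile \<mu> (cdf \<nu> (z2 y))))"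
    using mp_iso_comp[OF iso1 mp_iso_comp[OF iso(1) mp_iso_sym[OF iso2]]] by simp
  have gz: "(\<lambda>x. g (z1 x)) \<in> measure_preserving M \<nu>"
    using measure_preserving_comp iso1 iso(1) unfolding mp_iso_def by blast
  have "AE x in M. z2 (r2 (g (z1 x))) = g (z1 x)"
    by (rule AE_measure_preserving[OF gz]) (use iso2 in \<open>simp add: mp_iso_def\<close>)
  moreover have "AE x in M. \<forall>c. cdf \<mu> c = cdf \<nu> c \<longrightarrow> (z1 x \<le> c \<longleftrightarrow> g (z1 x) \<le> c)"
    by (rule AE_measure_preserving[OF _ iso(2)]) (use iso1 in \<open>simp add: mp_iso_def\<close>)
  ultimately have "AE x in M. p2 (r2 (g (z1 x))) = p1 x"
  proof eventually_elim
    case (elim x)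
    then have "p2 (r2 (g (z1 x))) \<le> k \<longleftrightarrow> p1 x \<le> k" for k
      using cdf_eq unfolding pz1 pz2 by simp
    then show ?case by (meson order_antisym order_refl)
  qed
  then show ?thesis using t by blast
qed

section \<open>Couplings and their topology\<close>

lemma space_circ [simp]: "space circ = {0..<1}"
  by (simp add: circ_def space_restrict_space)

lemma prob_space_circ: "prob_space circ"
  by (rule prob_spaceI) (simp add: circ_def space_restrict_space emeasure_restrict_space)

lemma measurable_circ_iff:
  "f \<in> M \<rightarrow>\<^sub>M circ \<longleftrightarrow> f \<in> borel_measurable M \<and> (\<forall>x\<in>space M. 0 \<le> f x \<and> f x < 1)"
  unfolding circ_def by (auto simp: measurable_restrict_space2_iff)

lemma sets_circ: "A \<in> sets circ \<longleftrightarrow> A \<in> sets borel \<and> A \<subseteq> {0..<1}"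
  unfolding circ_def by (subst sets_restrict_space_iff) auto

lemma emeasure_circ: "A \<in> sets circ \<Longrightarrow> emeasure circ A = emeasure lborel A"
  unfolding circ_def by (subst emeasure_restrict_space) (auto simp: sets_restrict_space_iff)

lemma space_Ylam: "space Ylam = {y. \<forall>n. 0 \<le> y n \<and> y n < 1}"
  by (auto simp: Ylam_def space_PiM PiE_def Pi_def)

lemma prob_space_Ylam: "prob_space Ylam"
  unfolding Ylam_def by (intro prob_space_PiM prob_space_circ)

interpretation Y: prob_space Ylam by (rule prob_space_Ylam)

lemma measurable_Ylam_component': "(\<lambda>y. y n) \<in> Ylam \<rightarrow>\<^sub>M circ"
  unfolding Ylam_def by measurable

lemma measurable_Ylam_component: "(\<lambda>y. y n) \<in> borel_measurable Ylam"
  using measurable_Ylam_component' measurable_circ_iff by blast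

lemma measurable_into_Ylam:
  assumes "\<And>n. (\<lambda>x. f x n) \<in> M \<rightarrow>\<^sub>M circ"
  shows "f \<in> M \<rightarrow>\<^sub>M Ylam"
  unfolding Ylam_def
  by (rule measurable_PiM_single') (use assms measurable_space[OF assms] in auto)

lemma component_measure_preserving: "(\<lambda>y. y n) \<in> measure_preserving Ylam circ"
  using distr_PiM_component[of UNIV "\<lambda>_. circ" n] prob_space_circ measurable_Ylam_component'
  by (auto simp: measure_preserving_iff Ylam_def[symmetric])

text \<open>Fixing coordinate 0 is already a null event. If \<open>{y}\<close> is not measurable,
  for instance when \<open>y\<close> lies outside the space, \<open>emeasure\<close> is zero by
  convention.\<close>

lemma emeasure_Ylam_singleton: "emeasure Ylam {y} = 0"
proof (cases "{y} \<in> sets Ylam")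
  case True
  let ?A = "{y 0} \<inter> {0..<1}"
  have A: "?A \<in> sets circ" by (simp add: sets_circ)
  have "emeasure Ylam {y} \<le> emeasure Ylam ((\<lambda>y. y 0) -` ?A \<inter> space Ylam)"
    using sets.sets_into_space[OF True] measurable_sets[OF measurable_Ylam_component' A]
    by (intro emeasure_mono) (auto simp: space_Ylam)
  also have "\<dots> = emeasure circ ?A"
    using component_measure_preserving[of 0] A unfolding measure_preserving_def by blast
  also have "\<dots> \<le> emeasure lborel {y 0}"
    unfolding emeasure_circ[OF A] by (intro emeasure_mono) auto
  finally show ?thesis by simp
qed (simp add: emeasure_notin_sets)

text \<open>A Borel retraction of all real sequences onto \<open>space Ylam\<close>, through which
  the latter inherits a Cantor coding from a Polish space.\<close>

definition clip :: "pt \<Rightarrow> pt" where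
  "clip y = (\<lambda>n. if 0 \<le> y n \<and> y n < 1 then y n else 0)"

lemma measurable_clip [measurable]: "clip \<in> borel \<rightarrow>\<^sub>M Ylam"
proof (rule measurable_into_Ylam)
  fix n
  have [measurable]: "(\<lambda>y::pt. y n) \<in> borel_measurable borel"
    by (rule borel_measurable_continuous_onI) simp
  show "(\<lambda>x. clip x n) \<in> borel \<rightarrow>\<^sub>M circ"
    unfolding measurable_circ_iff clip_def by auto
qed

lemma clip_id: "y \<in> space Ylam \<Longrightarrow> clip y = y"
  by (auto simp: clip_def space_Ylam)

lemma measurable_Ylam_borel: "(\<lambda>y. y) \<in> Ylam \<rightarrow>\<^sub>M borel"
  by (rule measurable_coordinatewise_then_product) (rule measurable_Ylam_component)

lemma cantor_retract_Ylam: "cantor_retract Ylam"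
proof (rule cantor_retract_of_retract)
  show "cantor_retract (borel :: pt measure)"
    by (rule standard_borel_cantor_retract[OF standard_borel_borel]) simp
  show "(\<lambda>y. y) \<in> Ylam \<rightarrow>\<^sub>M borel" by (rule measurable_Ylam_borel)
  show "clip \<in> borel \<rightarrow>\<^sub>M Ylam" by measurable
qed (simp add: clip_id)

text \<open>Serves the space on which a coupling is enlarged by an independent copy of
  \<open>Ylam\<close>.\<close>

lemma cantor_retract_Ylam3: "cantor_retract ((Ylam \<Otimes>\<^sub>M Ylam) \<Otimes>\<^sub>M Ylam)"
proof (rule cantor_retract_of_retract)
  show "cantor_retract (borel :: ((pt \<times> pt) \<times> pt) measure)"
    by (rule standard_borel_cantor_retract[OF standard_borel_borel]) simp
  show "(\<lambda>z. ((fst (fst z), snd (fst z)), snd z)) \<in> (Ylam \<Otimes>\<^sub>M Ylam) \<Otimes>\<^sub>M Ylam \<rightarrow>\<^sub>M borel"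
    unfolding borel_prod[symmetric]
    by (intro measurable_Pair measurable_compose[OF _ measurable_Ylam_borel]) measurable
  show "(\<lambda>z. ((clip (fst (fst z)), clip (snd (fst z))), clip (snd z))) \<in> borel \<rightarrow>\<^sub>M (Ylam \<Otimes>\<^sub>M Ylam) \<Otimes>\<^sub>M Ylam"
    unfolding borel_prod[symmetric] by measurable
qed (auto simp: space_pair_measure clip_id)

section \<open>Couplings, graph couplings and the rectangle topology\<close>

lemma C2_iff: "\<rho> \<in> C2 \<longleftrightarrow> sets \<rho> = sets (Ylam \<Otimes>\<^sub>M Ylam) \<and> prob_space \<rho>
    \<and> fst \<in> measure_preserving \<rho> Ylam \<and> snd \<in> measure_preserving \<rho> Ylam"
proof -
  have "sets \<rho> = sets (Ylam \<Otimes>\<^sub>M Ylam) \<Longrightarrow> space \<rho> = space (Ylam \<Otimes>\<^sub>M Ylam)"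
    by (rule sets_eq_imp_space_eq)
  moreover have "fst \<in> \<rho> \<rightarrow>\<^sub>M Ylam" "snd \<in> \<rho> \<rightarrow>\<^sub>M Ylam" if "sets \<rho> = sets (Ylam \<Otimes>\<^sub>M Ylam)"
    using measurable_cong_sets[OF that refl] measurable_fst measurable_snd by blast+
  ultimately show ?thesis unfolding C2_def measure_preserving_iff by blast
qed

lemma graph_measurable:
  "S \<in> Ylam \<rightarrow>\<^sub>M Ylam \<Longrightarrow> (\<lambda>y. (S y, y)) \<in> Ylam \<rightarrow>\<^sub>M Ylam \<Otimes>\<^sub>M Ylam"
  by (intro measurable_Pair measurable_ident_sets refl)

lemma graph_coupling_in_C2:
  assumes S: "S \<in> measure_preserving Ylam Ylam"
  shows "graph_coupling S \<in> C2"
proof -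
  have [measurable]: "S \<in> Ylam \<rightarrow>\<^sub>M Ylam" using S by (rule measure_preserving_measurable)
  have "prob_space (graph_coupling S)" unfolding graph_coupling_def by (rule Y.prob_space_distr[OF graph_measurable]) simp
  moreover have "distr (graph_coupling S) Ylam fst = Ylam" "distr (graph_coupling S) Ylam snd = Ylam"
    using S unfolding graph_coupling_def
    by (simp_all add: distr_distr[OF _ graph_measurable] comp_def measure_preserving_distr measurable_fst measurable_snd)
  ultimately show ?thesis
    unfolding C2_def by (simp add: graph_coupling_def)
qed

lemma measure_graph_coupling:
  assumes [measurable]: "S \<in> Ylam \<rightarrow>\<^sub>M Ylam" "A \<in> sets Ylam" "B \<in> sets Ylam"
  shows "measure (graph_coupling S) (A \<times> B) = measure Ylam {y \<in> space Ylam. S y \<in> A \<and> y \<in> B}"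
  unfolding graph_coupling_def
  by (subst measure_distr[OF graph_measurable]) (auto intro!: arg_cong[where f="measure Ylam"])

lemma AutC2_subset: "AutC2 \<subseteq> C2"
  using graph_coupling_in_C2 by (auto simp: AutC2_def Aut_def)

lemma topspace_C2 [simp]: "topspace C2_top = C2"
  by (simp add: C2_top_def topspace_pullback_topology)

lemma openin_C2_top: "openin C2_top U \<longleftrightarrow> (\<exists>V. open V \<and> U = rect_eval -` V \<inter> C2)"
  by (simp add: C2_top_def openin_pullback_topology)

lemma continuous_map_into_C2:
  fixes g :: "'a \<Rightarrow> (pt \<times> pt) measure"
  assumes "g ` topspace X \<subseteq> C2"
    and "\<And>A B. A \<in> sets Ylam \<Longrightarrow> B \<in> sets Ylam \<Longrightarrow> continuous_map X euclideanreal (\<lambda>x. measure (g x) (A \<times> B))"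
  shows "continuous_map X C2_top g"
proof -
  have "continuous_map X (product_topology (\<lambda>_. euclideanreal) UNIV) (\<lambda>x. rect_eval (g x))"
    unfolding continuous_map_componentwise_UNIV
  proof safe
    fix A B
    show "continuous_map X euclideanreal (\<lambda>x. rect_eval (g x) (A, B))"
      by (cases "A \<in> sets Ylam \<and> B \<in> sets Ylam") (use assms(2) in \<open>auto simp: rect_eval_def\<close>)
  qed
  then have "continuous_map X euclidean (\<lambda>x. rect_eval (g x))" by (simp add: euclidean_product_topology)
  then show ?thesis
    unfolding C2_top_def using assms(1) by (intro continuous_map_pullback') (auto simp: comp_def)
qed

lemma continuous_map_rect_eval: "continuous_map C2_top euclidean rect_eval"
  unfolding C2_top_def using continuous_map_pullback[of euclidean euclidean id] by auto

lemma continuous_map_rect: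
  assumes "A \<in> sets Ylam" "B \<in> sets Ylam"
  shows "continuous_map C2_top euclideanreal (\<lambda>\<rho>. measure \<rho> (A \<times> B))"
proof -
  have "continuous_map C2_top (product_topology (\<lambda>_. euclideanreal) UNIV) rect_eval"
    using continuous_map_rect_eval by (simp add: euclidean_product_topology)
  then have "continuous_map C2_top euclideanreal (\<lambda>x. rect_eval x (A, B))"
    unfolding continuous_map_componentwise_UNIV by blast
  then show ?thesis using assms by (simp add: rect_eval_def)
qed

lemma C2_eqI:
  assumes "\<rho> \<in> C2" "\<sigma> \<in> C2"
    and eq: "\<And>A B. A \<in> sets Ylam \<Longrightarrow> B \<in> sets Ylam \<Longrightarrow> measure \<rho> (A \<times> B) = measure \<sigma> (A \<times> B)"
  shows "\<rho> = \<sigma>"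
proof (rule measure_eqI_generator_eq[OF Int_stable_pair_measure_generator[of Ylam Ylam]])
  interpret r: prob_space \<rho> using assms by (simp add: C2_iff)
  interpret s: prob_space \<sigma> using assms by (simp add: C2_iff)
  show "{a \<times> b |a b. a \<in> sets Ylam \<and> b \<in> sets Ylam} \<subseteq> Pow (space Ylam \<times> space Ylam)"
    using sets.sets_into_space by auto
  show "emeasure \<rho> X = emeasure \<sigma> X" if "X \<in> {a \<times> b |a b. a \<in> sets Ylam \<and> b \<in> sets Ylam}" for X
    using that eq by (auto simp: r.emeasure_eq_measure s.emeasure_eq_measure)
  show "sets \<rho> = sigma_sets (space Ylam \<times> space Ylam) {a \<times> b |a b. a \<in> sets Ylam \<and> b \<in> sets Ylam}"
       "sets \<sigma> = sigma_sets (space Ylam \<times> space Ylam) {a \<times> b |a b. a \<in> sets Ylam \<and> b \<in> sets Ylam}"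
    using assms by (auto simp: C2_iff sets_pair_measure)
  show "range (\<lambda>n::nat. space Ylam \<times> space Ylam) \<subseteq> {a \<times> b |a b. a \<in> sets Ylam \<and> b \<in> sets Ylam}"
    by auto
  show "emeasure \<rho> (space Ylam \<times> space Ylam) \<noteq> \<infinity>" for n :: nat
    by simp
qed simp

text \<open>Measures of rectangles separate couplings, so \<open>rect_eval\<close> is injective on
  \<open>C2\<close>. This is what makes compact images closed later on.\<close>

lemma Hausdorff_C2: "Hausdorff_space C2_top"
proof (rule Hausdorff_space_injective_preimage[OF _ continuous_map_rect_eval])
  show "Hausdorff_space (euclidean :: ((pt set \<times> pt set) \<Rightarrow> real) topology)"
    by (simp add: euclidean_product_topology[symmetric] Hausdorff_space_product_topology)
  show "inj_on rect_eval (topspace C2_top)"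
  proof (rule inj_onI)
    fix \<rho> \<sigma> assume "\<rho> \<in> topspace C2_top" "\<sigma> \<in> topspace C2_top" and eq: "rect_eval \<rho> = rect_eval \<sigma>"
    have "measure \<rho> (A \<times> B) = measure \<sigma> (A \<times> B)" if "A \<in> sets Ylam" "B \<in> sets Ylam" for A B
      using fun_cong[OF eq, of "(A, B)"] that by (simp add: rect_eval_def)
    with \<open>\<rho> \<in> topspace C2_top\<close> \<open>\<sigma> \<in> topspace C2_top\<close> show "\<rho> = \<sigma>"
      by (intro C2_eqI) auto
  qed
qed

section \<open>Graph couplings form a Gdelta set\<close>

text \<open>Choose approximants with errors below \<open>(1/2)^k\<close>. The errors are summable,
  so by Borel-Cantelli almost every point is misclassified only finitely often, and the lower limit
  of the approximants is exact.\<close>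

lemma (in prob_space) exact_event_of_approximations:
  assumes [measurable]: "X \<in> events" "f \<in> M \<rightarrow>\<^sub>M N"
    and approx: "\<And>e. e > 0 \<Longrightarrow> \<exists>B\<in>sets N. prob {z \<in> space M. (z \<in> X) \<noteq> (f z \<in> B)} < e"
  shows "\<exists>B\<in>sets N. AE z in M. z \<in> X \<longleftrightarrow> f z \<in> B"
proof -
  have "\<exists>B\<in>sets N. prob {z \<in> space M. (z \<in> X) \<noteq> (f z \<in> B)} < (1/2)^k" for k :: nat
    using approx by simp
  then obtain B where B[measurable]: "\<And>k. B k \<in> sets N"
    and err: "\<And>k. prob {z \<in> space M. (z \<in> X) \<noteq> (f z \<in> B k)} < (1/2)^k"
    by metis
  define L where "L = {y \<in> space N. \<exists>m. \<forall>n\<ge>m. y \<in> B n}"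
  have [measurable]: "L \<in> sets N" unfolding L_def by measurable
  have "AE z in M. eventually (\<lambda>k. z \<in> space M - {z \<in> space M. (z \<in> X) \<noteq> (f z \<in> B k)}) sequentially"
  proof (rule borel_cantelli_AE1)
    show "summable (\<lambda>k. prob {z \<in> space M. (z \<in> X) \<noteq> (f z \<in> B k)})"
      by (rule summable_comparison_test[OF _ summable_geometric[of "1/2::real"]])
         (use err in \<open>auto intro!: exI[of _ 0] less_imp_le\<close>)
  qed (auto simp: emeasure_eq_measure)
  then have "AE z in M. z \<in> X \<longleftrightarrow> f z \<in> L"
  proof (rule AE_mp, intro AE_I2 impI)
    fix z assume z: "z \<in> space M"
      and "eventually (\<lambda>k. z \<in> space M - {z \<in> space M. (z \<in> X) \<noteq> (f z \<in> B k)}) sequentially"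
    then obtain m where m: "\<And>k. k \<ge> m \<Longrightarrow> (z \<in> X) = (f z \<in> B k)"
      unfolding eventually_sequentially by auto
    have "f z \<in> space N" using z assms(2) measurable_space by metis
    then show "z \<in> X \<longleftrightarrow> f z \<in> L"
      unfolding L_def using m by simp (metis max.cobounded1 max.cobounded2)
  qed
  then show ?thesis using \<open>L \<in> sets N\<close> by blast
qed

text \<open>A Doob-Dynkin factorization: \<open>s\<close> decodes the digits that \<open>f\<close>
  determines. Since \<open>R\<close> is total, \<open>s\<close> takes values in \<open>L\<close>
  even where these digits code no point.\<close>

lemma AE_function_of_digits:
  assumes E: "E \<in> L \<rightarrow>\<^sub>M cantor" and R: "R \<in> cantor \<rightarrow>\<^sub>M L" and RE: "\<And>x. x \<in> space L \<Longrightarrow> R (E x) = x"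
    and g: "g \<in> M \<rightarrow>\<^sub>M L"
    and dig: "\<And>n. \<exists>B\<in>sets N. AE z in M. E (g z) n \<longleftrightarrow> f z \<in> B"
  shows "\<exists>s\<in>N \<rightarrow>\<^sub>M L. AE z in M. g z = s (f z)"
proof -
  obtain B where B[measurable]: "\<And>n. B n \<in> sets N" and Bd: "\<And>n. AE z in M. E (g z) n \<longleftrightarrow> f z \<in> B n"
    using dig by metis
  have "(\<lambda>y n. y \<in> B n) \<in> N \<rightarrow>\<^sub>M cantor" by (rule measurable_into_cantor) simp
  then have "(\<lambda>y. R (\<lambda>n. y \<in> B n)) \<in> N \<rightarrow>\<^sub>M L" using R by (rule measurable_compose)
  moreover have "AE z in M. \<forall>n. E (g z) n \<longleftrightarrow> f z \<in> B n" using Bd by (simp add: AE_all_countable)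
  then have "AE z in M. g z = R (\<lambda>n. f z \<in> B n)"
  proof (rule AE_mp, intro AE_I2 impI)
    fix z assume z: "z \<in> space M" and *: "\<forall>n. E (g z) n \<longleftrightarrow> f z \<in> B n"
    have "(\<lambda>n. f z \<in> B n) = E (g z)" using * by auto
    then show "g z = R (\<lambda>n. f z \<in> B n)" using RE measurable_space[OF g z] by simp
  qed
  ultimately show ?thesis by (intro bexI[of _ "\<lambda>y. R (\<lambda>n. y \<in> B n)"])
qed

text \<open>Almost everywhere \<open>s (snd z)\<close> is \<open>fst z\<close>, which has law
  \<open>Ylam\<close>, as does \<open>snd z\<close>; so \<open>s\<close> preserves
  \<open>Ylam\<close>, and likewise \<open>s'\<close>. Substituting one equation into the other
  makes them mutually inverse.\<close>

lemma coupling_AE_graph: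
  assumes \<rho>: "\<rho> \<in> C2" and s: "s \<in> Ylam \<rightarrow>\<^sub>M Ylam" "AE z in \<rho>. fst z = s (snd z)"
    and s': "s' \<in> Ylam \<rightarrow>\<^sub>M Ylam" "AE z in \<rho>. snd z = s' (fst z)"
  shows "\<rho> \<in> AutC2"
proof -
  have fs: "fst \<in> measure_preserving \<rho> Ylam" "snd \<in> measure_preserving \<rho> Ylam" and sets: "sets \<rho> = sets (Ylam \<Otimes>\<^sub>M Ylam)"
    using \<rho> by (auto simp: C2_iff)
  note fm = fs[THEN measure_preserving_measurable] and fd = fs[THEN measure_preserving_distr]
  have sm: "(\<lambda>z. s (snd z)) \<in> \<rho> \<rightarrow>\<^sub>M Ylam" "(\<lambda>z. s' (fst z)) \<in> \<rho> \<rightarrow>\<^sub>M Ylam"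
    using fm s s' measurable_compose by blast+
  have mp: "(\<lambda>z. s (snd z)) \<in> measure_preserving \<rho> Ylam" "(\<lambda>z. s' (fst z)) \<in> measure_preserving \<rho> Ylam"
    using measure_preserving_cong_AE[OF fs(1) sm(1)] measure_preserving_cong_AE[OF fs(2) sm(2)] s s' by auto
  have S: "s \<in> measure_preserving Ylam Ylam"
    using measure_preserving_distr[OF mp(1)] s(1) distr_distr[OF s(1) fm(2)] fd
    by (simp add: measure_preserving_iff comp_def)
  have S': "s' \<in> measure_preserving Ylam Ylam"
    using measure_preserving_distr[OF mp(2)] s'(1) distr_distr[OF s'(1) fm(1)] fd
    by (simp add: measure_preserving_iff comp_def)
  \<comment> \<open>Transporting an almost sure equality to a marginal requires a measurable set of
    agreement; here it is cut out by countably many coordinate equations.\<close>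
  have diag: "{y \<in> space Ylam. h y = y} \<in> sets Ylam" if h: "h \<in> Ylam \<rightarrow>\<^sub>M Ylam" for h
  proof -
    have "(\<lambda>y. h y n) \<in> borel_measurable Ylam" for n
      using measurable_compose[OF h measurable_Ylam_component] .
    then have "{y \<in> space Ylam. \<forall>n. h y n = y n} \<in> sets Ylam"
      by (intro sets.sets_Collect_countable_All borel_measurable_eq measurable_Ylam_component)
    then show ?thesis by (simp add: fun_eq_iff)
  qed
  have "AE z in \<rho>. s' (s (snd z)) = snd z" "AE z in \<rho>. s (s' (fst z)) = fst z"
    using s(2) s'(2) by (eventually_elim, simp)+
  then have "AE y in distr \<rho> Ylam snd. s' (s y) = y" "AE y in distr \<rho> Ylam fst. s (s' y) = y"
    using diag[OF measurable_compose[OF s(1) s'(1)]] diag[OF measurable_compose[OF s'(1) s(1)]] fm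
    by (simp_all add: AE_distr_iff)
  then have "s \<in> Aut Ylam" unfolding fd Aut_def using S S' by blast
  moreover have "\<rho> = graph_coupling s"
  proof -
    have "\<rho> = distr \<rho> (Ylam \<Otimes>\<^sub>M Ylam) (\<lambda>z. z)" using sets by (simp add: distr_id2)
    also have "\<dots> = distr \<rho> (Ylam \<Otimes>\<^sub>M Ylam) (\<lambda>z. (s (snd z), snd z))"
    proof (rule distr_cong_AE)
      show "AE z in \<rho>. z = (s (snd z), snd z)" using s(2) by eventually_elim (simp add: prod_eq_iff)
      show "(\<lambda>z. z) \<in> \<rho> \<rightarrow>\<^sub>M Ylam \<Otimes>\<^sub>M Ylam" using sets by (rule measurable_ident_sets)
      show "(\<lambda>z. (s (snd z), snd z)) \<in> \<rho> \<rightarrow>\<^sub>M Ylam \<Otimes>\<^sub>M Ylam" using sm fm by (intro measurable_Pair)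
    qed auto
    also have "\<dots> = distr (distr \<rho> Ylam snd) (Ylam \<Otimes>\<^sub>M Ylam) (\<lambda>y. (s y, y))"
      using distr_distr[OF graph_measurable[OF s(1)] fm(2)] by (simp add: comp_def)
    finally show ?thesis using fd by (simp add: graph_coupling_def)
  qed
  ultimately show ?thesis by (auto simp: AutC2_def)
qed

lemma measure_graph_coupling_eq_0:
  assumes "S \<in> Ylam \<rightarrow>\<^sub>M Ylam" "A \<in> sets Ylam" "B \<in> sets Ylam" "AE y in Ylam. \<not> (S y \<in> A \<and> y \<in> B)"
  shows "measure (graph_coupling S) (A \<times> B) = 0"
  using measure_graph_coupling[OF assms(1-3)] emeasure_eq_0_AE[OF assms(4)]
  by (simp add: Y.emeasure_eq_measure)

lemma gdelta_AutC2: "gdelta_in C2_top AutC2"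
proof -
  let ?Y = "space Ylam"
  obtain E R where E: "E \<in> Ylam \<rightarrow>\<^sub>M cantor" and R: "R \<in> cantor \<rightarrow>\<^sub>M Ylam" and RE: "\<And>x. x \<in> ?Y \<Longrightarrow> R (E x) = x"
    using cantor_retract_Ylam unfolding cantor_retract_def by blast
  define A where "A n = {x \<in> ?Y. E x n}" for n
  have A[measurable]: "A n \<in> sets Ylam" for n
    unfolding A_def using measurable_compose[OF E measurable_cantor_component] by (simp add: pred_def)
  \<comment> \<open>The two rectangles form the symmetric difference of the events
    \<open>fst z \<in> A n\<close> and \<open>snd z \<in> B\<close>. The union over \<open>B\<close>
    is uncountable but still open, so only \<open>n\<close> and \<open>k\<close> have to run through
    countable sets.\<close>
  define U where "U n k = (\<Union>B\<in>sets Ylam. {\<rho> \<in> C2. measure \<rho> (A n \<times> (?Y - B)) + measure \<rho> ((?Y - A n) \<times> B) < 1 / real (Suc k)})" for n k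
  \<comment> \<open>The same with the coordinates exchanged: \<open>U\<close> makes the first
    coordinate a function of the second, and \<open>V\<close> supplies the inverse function.\<close>
  define V where "V n k = (\<Union>B\<in>sets Ylam. {\<rho> \<in> C2. measure \<rho> ((?Y - B) \<times> A n) + measure \<rho> (B \<times> (?Y - A n)) < 1 / real (Suc k)})" for n k
  have op: "openin C2_top {\<rho> \<in> C2. measure \<rho> (A1 \<times> B1) + measure \<rho> (A2 \<times> B2) < e}"
    if "A1 \<in> sets Ylam" "B1 \<in> sets Ylam" "A2 \<in> sets Ylam" "B2 \<in> sets Ylam" for A1 B1 A2 B2 e
  proof -
    have "continuous_map C2_top euclideanreal (\<lambda>\<rho>. measure \<rho> (A1 \<times> B1) + measure \<rho> (A2 \<times> B2))"
      using that by (intro continuous_map_add continuous_map_rect)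
    from openin_continuous_map_preimage[OF this, of "{..<e}"] show ?thesis by simp
  qed
  have UV: "openin C2_top (U n k)" "openin C2_top (V n k)" for n k
    unfolding U_def V_def by (auto intro!: openin_Union op)
  have "AutC2 = (\<Inter>n. \<Inter>k. U n k \<inter> V n k)"
  proof (intro equalityI subsetI)
    fix \<rho> assume "\<rho> \<in> AutC2"
    then obtain S S' where \<rho>: "\<rho> = graph_coupling S" and S: "S \<in> measure_preserving Ylam Ylam"
      and S': "S' \<in> measure_preserving Ylam Ylam" "AE y in Ylam. S' (S y) = y"
      by (auto simp: AutC2_def Aut_def)
    note [measurable] = measure_preserving_measurable[OF S] measure_preserving_measurable[OF S'(1)]
    have r: "\<rho> \<in> C2" using \<rho> S graph_coupling_in_C2 by simp
    have "\<rho> \<in> U n k" for n k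
    proof -
      let ?B = "{y \<in> ?Y. S y \<in> A n}"
      have "measure \<rho> (A n \<times> (?Y - ?B)) = 0" "measure \<rho> ((?Y - A n) \<times> ?B) = 0"
        unfolding \<rho> by (rule measure_graph_coupling_eq_0; auto intro!: AE_I2)+
      then show ?thesis using r unfolding U_def by (intro UN_I[of ?B]) auto
    qed
    moreover have "\<rho> \<in> V n k" for n k
    proof -
      let ?B = "{x \<in> ?Y. S' x \<in> A n}"
      have "measure \<rho> ((?Y - ?B) \<times> A n) = 0" "measure \<rho> (?B \<times> (?Y - A n)) = 0"
      proof -
        have "AE y in Ylam. \<not> (S y \<in> ?Y - ?B \<and> y \<in> A n)" "AE y in Ylam. \<not> (S y \<in> ?B \<and> y \<in> ?Y - A n)"
          using S'(2) by (eventually_elim, auto)+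
        then show "measure \<rho> ((?Y - ?B) \<times> A n) = 0" "measure \<rho> (?B \<times> (?Y - A n)) = 0"
          unfolding \<rho> by (intro measure_graph_coupling_eq_0; measurable)+
      qed
      then show ?thesis using r unfolding V_def by (intro UN_I[of ?B]) auto
    qed
    ultimately show "\<rho> \<in> (\<Inter>n. \<Inter>k. U n k \<inter> V n k)" by blast
  next
    fix \<rho> assume *: "\<rho> \<in> (\<Inter>n. \<Inter>k. U n k \<inter> V n k)"
    then have \<rho>: "\<rho> \<in> C2" unfolding U_def by blast
    interpret r: prob_space \<rho> using \<rho> by (simp add: C2_iff)
    have sets: "sets \<rho> = sets (Ylam \<Otimes>\<^sub>M Ylam)" using \<rho> by (simp add: C2_iff)
    have space: "space \<rho> = ?Y \<times> ?Y" using sets_eq_imp_space_eq[OF sets] by (simp add: space_pair_measure)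
    have fm: "fst \<in> \<rho> \<rightarrow>\<^sub>M Ylam" "snd \<in> \<rho> \<rightarrow>\<^sub>M Ylam"
      using \<rho> by (auto simp: C2_iff intro: measure_preserving_measurable)
    have rect: "X \<times> Z \<in> sets \<rho>" if "X \<in> sets Ylam" "Z \<in> sets Ylam" for X Z
      using that sets by simp
    have small: "\<exists>k. 1 / real (Suc k) < e" if "e > 0" for e :: real
      using that by (metis nat_approx_posE)
    have d1: "\<exists>B\<in>sets Ylam. AE z in \<rho>. z \<in> A n \<times> ?Y \<longleftrightarrow> snd z \<in> B" for n
    proof (rule r.exact_event_of_approximations[OF rect fm(2)])
      fix e :: real assume "e > 0"
      then obtain k where k: "1 / real (Suc k) < e" using small by blast
      have "\<rho> \<in> U n k" using * by blast
      then obtain B where B: "B \<in> sets Ylam" "measure \<rho> (A n \<times> (?Y - B)) + measure \<rho> ((?Y - A n) \<times> B) < 1 / real (Suc k)"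
        unfolding U_def by blast
      have "{z \<in> space \<rho>. (z \<in> A n \<times> ?Y) \<noteq> (snd z \<in> B)} = A n \<times> (?Y - B) \<union> (?Y - A n) \<times> B"
        using sets.sets_into_space[OF A] sets.sets_into_space[OF B(1)] by (auto simp: space)
      then have "r.prob {z \<in> space \<rho>. (z \<in> A n \<times> ?Y) \<noteq> (snd z \<in> B)} \<le> measure \<rho> (A n \<times> (?Y - B)) + measure \<rho> ((?Y - A n) \<times> B)"
        using measure_Un_le[of "A n \<times> (?Y - B)" \<rho> "(?Y - A n) \<times> B"] rect B by simp
      then show "\<exists>B\<in>sets Ylam. r.prob {z \<in> space \<rho>. (z \<in> A n \<times> ?Y) \<noteq> (snd z \<in> B)} < e"
        using B k by force
    qed auto
    have d2: "\<exists>B\<in>sets Ylam. AE z in \<rho>. z \<in> ?Y \<times> A n \<longleftrightarrow> fst z \<in> B" for n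
    proof (rule r.exact_event_of_approximations[OF rect fm(1)])
      fix e :: real assume "e > 0"
      then obtain k where k: "1 / real (Suc k) < e" using small by blast
      have "\<rho> \<in> V n k" using * by blast
      then obtain B where B: "B \<in> sets Ylam" "measure \<rho> ((?Y - B) \<times> A n) + measure \<rho> (B \<times> (?Y - A n)) < 1 / real (Suc k)"
        unfolding V_def by blast
      have "{z \<in> space \<rho>. (z \<in> ?Y \<times> A n) \<noteq> (fst z \<in> B)} = (?Y - B) \<times> A n \<union> B \<times> (?Y - A n)"
        using sets.sets_into_space[OF A] sets.sets_into_space[OF B(1)] by (auto simp: space)
      then have "r.prob {z \<in> space \<rho>. (z \<in> ?Y \<times> A n) \<noteq> (fst z \<in> B)} \<le> measure \<rho> ((?Y - B) \<times> A n) + measure \<rho> (B \<times> (?Y - A n))"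
        using measure_Un_le[of "(?Y - B) \<times> A n" \<rho> "B \<times> (?Y - A n)"] rect B by simp
      then show "\<exists>B\<in>sets Ylam. r.prob {z \<in> space \<rho>. (z \<in> ?Y \<times> A n) \<noteq> (fst z \<in> B)} < e"
        using B k by force
    qed auto
    have "\<exists>B\<in>sets Ylam. AE z in \<rho>. E (fst z) n \<longleftrightarrow> snd z \<in> B" for n
    proof -
      obtain B where "B \<in> sets Ylam" and *: "AE z in \<rho>. z \<in> A n \<times> ?Y \<longleftrightarrow> snd z \<in> B" using d1 by blast
      moreover have "AE z in \<rho>. E (fst z) n \<longleftrightarrow> snd z \<in> B"
        using * by (rule AE_mp) (auto intro!: AE_I2 simp: space A_def)
      ultimately show ?thesis by blast
    qed
    then obtain s where s: "s \<in> Ylam \<rightarrow>\<^sub>M Ylam" "AE z in \<rho>. fst z = s (snd z)"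
      using AE_function_of_digits[OF E R RE fm(1)] by blast
    have "\<exists>B\<in>sets Ylam. AE z in \<rho>. E (snd z) n \<longleftrightarrow> fst z \<in> B" for n
    proof -
      obtain B where "B \<in> sets Ylam" and *: "AE z in \<rho>. z \<in> ?Y \<times> A n \<longleftrightarrow> fst z \<in> B" using d2 by blast
      moreover have "AE z in \<rho>. E (snd z) n \<longleftrightarrow> fst z \<in> B"
        using * by (rule AE_mp) (auto intro!: AE_I2 simp: space A_def)
      ultimately show ?thesis by blast
    qed
    then obtain s' where s': "s' \<in> Ylam \<rightarrow>\<^sub>M Ylam" "AE z in \<rho>. snd z = s' (fst z)"
      using AE_function_of_digits[OF E R RE fm(2)] by blast
    show "\<rho> \<in> AutC2" by (rule coupling_AE_graph[OF \<rho> s s'])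
  qed
  also have "\<dots> = \<Inter> ((\<lambda>(n, k). U n k \<inter> V n k) ` UNIV)" by auto
  also have "gdelta_in C2_top \<dots>"
    by (rule gdelta_in_Inter) (auto intro!: open_imp_gdelta_in openin_Int UV)
  finally show ?thesis .
qed

section \<open>Density of the graph couplings and the lens map\<close>

lemma cantor_retract_cong_sets:
  assumes "sets M = sets N" "cantor_retract N"
  shows "cantor_retract M"
  using assms(2) unfolding cantor_retract_def measurable_cong_sets[OF assms(1) refl]
    measurable_cong_sets[OF refl assms(1)] sets_eq_imp_space_eq[OF assms(1)] .

lemma fst_measure_preserving:
  assumes "sigma_finite_measure M" "prob_space N"
  shows "fst \<in> measure_preserving (M \<Otimes>\<^sub>M N) M"
proof -
  interpret N: prob_space N by fact
  have "emeasure (M \<Otimes>\<^sub>M N) (fst -` A \<inter> space (M \<Otimes>\<^sub>M N)) = emeasure M A" if A: "A \<in> sets M" for A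
  proof -
    have "fst -` A \<inter> space (M \<Otimes>\<^sub>M N) = A \<times> space N"
      using sets.sets_into_space[OF A] by (auto simp: space_pair_measure)
    then show ?thesis using N.emeasure_pair_measure_Times[OF A sets.top] by (simp add: N.emeasure_space_1)
  qed
  then show ?thesis by (simp add: measure_preserving_def)
qed

text \<open>Let \<open>p\<close> record the atom of the finite partition generated by the given sets. The coupling
  enlarged by an independent factor is isomorphic to \<open>\<lambda>\<close> in two ways, turning \<open>p\<close> into \<open>p\<close> of the
  second resp. of the first coordinate; their quotient is the required automorphism.\<close>

lemma realize_coupling_on_finite_family:
  fixes E :: "nat \<Rightarrow> pt set" and n :: nat
  assumes \<rho>: "\<rho> \<in> C2" and E: "\<And>i. i < n \<Longrightarrow> E i \<in> sets Ylam"
  shows "\<exists>S\<in>Aut Ylam. \<forall>i<n. \<forall>j<n. measure (graph_coupling S) (E i \<times> E j) = measure \<rho> (E i \<times> E j)"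
proof -
  interpret r: prob_space \<rho> using \<rho> by (simp add: C2_iff)
  have sets: "sets \<rho> = sets (Ylam \<Otimes>\<^sub>M Ylam)" using \<rho> by (simp add: C2_iff)
  \<comment> \<open>An atom is named by the set of indices \<open>i\<close> with
    \<open>y \<in> E i\<close>, packed into one natural number, the form in which
    \<open>mp_iso_atomless\<close> takes a partition.\<close>
  define p where "p y = set_encode {i. i < n \<and> y \<in> E i}" for y
  have dec: "set_decode (p y) = {i. i < n \<and> y \<in> E i}" for y
    unfolding p_def by (rule set_encode_inverse) simp
  then have pE: "y \<in> E i \<longleftrightarrow> i \<in> set_decode (p y)" if "i < n" for i y
    using that by simp
  have p: "p \<in> Ylam \<rightarrow>\<^sub>M count_space UNIV"
  proof (subst measurable_count_space_eq2_countable, safe)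
    fix a
    have "p y = a \<longleftrightarrow> (\<forall>i. (i < n \<and> y \<in> E i) \<longleftrightarrow> i \<in> set_decode a)" for y
    proof
      show "p y = a \<Longrightarrow> \<forall>i. (i < n \<and> y \<in> E i) \<longleftrightarrow> i \<in> set_decode a" using dec[of y] by blast
      assume "\<forall>i. (i < n \<and> y \<in> E i) \<longleftrightarrow> i \<in> set_decode a"
      then have "set_decode (p y) = set_decode a" unfolding dec by blast
      then show "p y = a" using set_decode_inverse by metis
    qed
    then have eq: "p -` {a} \<inter> space Ylam = {y \<in> space Ylam. \<forall>i. (i < n \<and> y \<in> E i) \<longleftrightarrow> i \<in> set_decode a}"
      by auto
    show "p -` {a} \<inter> space Ylam \<in> sets Ylam"
      unfolding eq
    proof (rule sets.sets_Collect_countable_All)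
      fix i
      show "{y \<in> space Ylam. (i < n \<and> y \<in> E i) \<longleftrightarrow> i \<in> set_decode a} \<in> sets Ylam"
        using E[of i] by (cases "i < n"; cases "i \<in> set_decode a") auto
    qed
  qed auto
  define N where "N = \<rho> \<Otimes>\<^sub>M Ylam"
  have pairprob: "prob_space N"
    unfolding N_def by (intro prob_space_pair r.prob_space_axioms Y.prob_space_axioms)
  have "sets N = sets ((Ylam \<Otimes>\<^sub>M Ylam) \<Otimes>\<^sub>M Ylam)" unfolding N_def using sets by (intro sets_pair_measure_cong) auto
  then have ret: "cantor_retract N" using cantor_retract_Ylam3 by (rule cantor_retract_cong_sets)
  \<comment> \<open>Points are null on account of the independent last coordinate \<open>t\<close>.
    The case distinctions use that \<open>emeasure\<close> vanishes on non-measurable sets.\<close>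
  have atom: "emeasure N {x} = 0" if "x \<in> space N" for x
  proof -
    obtain z t where x: "x = (z, t)" by fastforce
    have "emeasure N ({z} \<times> {t}) \<le> emeasure N (space \<rho> \<times> {t})"
    proof (cases "{t} \<in> sets Ylam")
      case True
      then show ?thesis using that x by (intro emeasure_mono) (auto simp: N_def space_pair_measure)
    next
      case False
      have "{(z, t)} \<notin> sets N"
      proof
        assume "{(z, t)} \<in> sets N"
        then have "Pair z -` {(z, t)} \<in> sets Ylam" unfolding N_def by (rule sets_Pair1)
        moreover have "Pair z -` {(z, t)} = {t}" by auto
        ultimately show False using False by simp
      qed
      then show ?thesis by (simp add: emeasure_notin_sets)
    qed
    also have "\<dots> = 0"
    proof (cases "{t} \<in> sets Ylam")
      case True
      then show ?thesis unfolding N_def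
        by (subst Y.emeasure_pair_measure_Times) (auto simp: emeasure_Ylam_singleton)
    next
      case False
      have "space \<rho> \<times> {t} \<notin> sets N"
      proof
        assume *: "space \<rho> \<times> {t} \<in> sets N"
        obtain z where z: "z \<in> space \<rho>" using r.not_empty by blast
        have "Pair z -` (space \<rho> \<times> {t}) \<in> sets Ylam" using * unfolding N_def by (rule sets_Pair1)
        moreover have "Pair z -` (space \<rho> \<times> {t}) = {t}" using z by auto
        ultimately show False using False by simp
      qed
      then show ?thesis by (simp add: emeasure_notin_sets)
    qed
    finally show ?thesis using x by simp
  qed
  have f: "fst \<in> measure_preserving N \<rho>"
    unfolding N_def by (intro fst_measure_preserving r.sigma_finite_measure_axioms Y.prob_space_axioms)
  have q1: "(\<lambda>w. fst (fst w)) \<in> measure_preserving N Ylam" and q2: "(\<lambda>w. snd (fst w)) \<in> measure_preserving N Ylam"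
    using \<rho> measure_preserving_comp[OF f] by (auto simp: C2_iff)
  \<comment> \<open>\<open>q\<close> stands for either coordinate of the coupling. Since it has law
    \<open>Ylam\<close>, the partition read through \<open>q\<close> has the same law as
    \<open>p\<close> itself.\<close>
  have iso: "\<exists>f g. mp_iso Ylam N f g \<and> (AE y in Ylam. p (q (f y)) = p y)" if q: "q \<in> measure_preserving N Ylam" for q
  proof (rule mp_iso_atomless[OF Y.prob_space_axioms pairprob cantor_retract_Ylam ret _ atom p])
    show "(\<lambda>w. p (q w)) \<in> N \<rightarrow>\<^sub>M count_space UNIV"
      using measurable_compose[OF measure_preserving_measurable[OF q] p] .
    show "distr Ylam (count_space UNIV) p = distr N (count_space UNIV) (\<lambda>w. p (q w))"
      using distr_distr[OF p measure_preserving_measurable[OF q]] measure_preserving_distr[OF q]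
      by (simp add: comp_def)
  qed (auto simp: emeasure_Ylam_singleton)
  obtain f2 g2 where i2: "mp_iso Ylam N f2 g2" and p2: "AE y in Ylam. p (snd (fst (f2 y))) = p y"
    using iso[OF q2] by blast
  obtain f1 g1 where i1: "mp_iso Ylam N f1 g1" and p1: "AE y in Ylam. p (fst (fst (f1 y))) = p y"
    using iso[OF q1] by blast
  \<comment> \<open>Put \<open>w = f2 y\<close>. Then \<open>y\<close> lies in the atom of
    \<open>snd (fst w)\<close>, and \<open>S y\<close>, which \<open>f1\<close> sends back to
    \<open>w\<close>, lies in the atom of \<open>fst (fst w)\<close>. So \<open>(S y, y)\<close>
    visits the atoms exactly as a sample \<open>fst w\<close> of \<open>\<rho>\<close> does.\<close>
  define S where "S y = g1 (f2 y)" for y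
  have SA: "S \<in> Aut Ylam"
    unfolding Aut_iff_mp_iso S_def using mp_iso_comp[OF i2 mp_iso_sym[OF i1]] by blast
  have Smp: "S \<in> measure_preserving Ylam Ylam" using SA by (simp add: Aut_def)
  have f2: "f2 \<in> measure_preserving Ylam N" using i2 by (simp add: mp_iso_def)
  have "AE y in Ylam. f1 (g1 (f2 y)) = f2 y"
    by (rule AE_measure_preserving[OF f2]) (use i1 in \<open>simp add: mp_iso_def\<close>)
  moreover have "AE y in Ylam. p (fst (fst (f1 (S y)))) = p (S y)"
    by (rule AE_measure_preserving[OF Smp p1])
  ultimately have AE1: "AE y in Ylam. p (S y) = p (fst (fst (f2 y)))"
    unfolding S_def by eventually_elim simp
  have "measure (graph_coupling S) (E i \<times> E j) = measure \<rho> (E i \<times> E j)" if ij: "i < n" "j < n" for i j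
  proof -
    have ff: "(\<lambda>y. fst (f2 y)) \<in> measure_preserving Ylam \<rho>" using measure_preserving_comp[OF f2 f] .
    have Eij: "E i \<times> E j \<in> sets \<rho>" using E ij sets by simp
    have "measure (graph_coupling S) (E i \<times> E j) = measure Ylam {y \<in> space Ylam. S y \<in> E i \<and> y \<in> E j}"
      by (rule measure_graph_coupling) (use Smp E ij measure_preserving_measurable in auto)
    also have "\<dots> = measure Ylam ((\<lambda>y. fst (f2 y)) -` (E i \<times> E j) \<inter> space Ylam)"
    proof (rule Y.finite_measure_eq_AE)
      show "AE y in Ylam. y \<in> {y \<in> space Ylam. S y \<in> E i \<and> y \<in> E j} \<longleftrightarrow> y \<in> (\<lambda>y. fst (f2 y)) -` (E i \<times> E j) \<inter> space Ylam"
        using AE1 p2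
      proof eventually_elim
        case (elim y)
        have "S y \<in> E i \<longleftrightarrow> fst (fst (f2 y)) \<in> E i" "y \<in> E j \<longleftrightarrow> snd (fst (f2 y)) \<in> E j"
          using pE ij elim by simp_all
        then show ?case by (auto simp: mem_Times_iff)
      qed
      show "(\<lambda>y. fst (f2 y)) -` (E i \<times> E j) \<inter> space Ylam \<in> sets Ylam"
        using measurable_sets[OF measure_preserving_measurable[OF ff] Eij] .
      have "S \<in> Ylam \<rightarrow>\<^sub>M Ylam" using Smp by (rule measure_preserving_measurable)
      then show "{y \<in> space Ylam. S y \<in> E i \<and> y \<in> E j} \<in> sets Ylam"
        using E[OF ij(1)] E[OF ij(2)] by (auto intro!: sets.sets_Collect_conj)
    qed
    also have "\<dots> = measure \<rho> (E i \<times> E j)"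
      using ff Eij by (auto simp: measure_preserving_def measure_def)
    finally show ?thesis .
  qed
  then show ?thesis using SA by blast
qed

text \<open>A basic neighbourhood restricts finitely many values of \<open>rect_eval\<close>. The
  measurable sides of these rectangles are collected into one finite family, on which an
  automorphism reproduces the coupling exactly.\<close>

lemma AutC2_dense: "C2_top closure_of AutC2 = C2"
proof
  show "C2_top closure_of AutC2 \<subseteq> C2" using closure_of_subset_topspace[of C2_top] by simp
  show "C2 \<subseteq> C2_top closure_of AutC2"
  proof
    fix \<rho> assume \<rho>: "\<rho> \<in> C2"
    have "\<exists>\<sigma>. \<sigma> \<in> AutC2 \<and> \<sigma> \<in> U" if U: "\<rho> \<in> U" "openin C2_top U" for U
    proof -
      obtain V where V: "open V" "U = rect_eval -` V \<inter> C2" using U by (auto simp: openin_C2_top)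
      have "openin (product_topology (\<lambda>i. euclideanreal) UNIV) V" using V(1) by (simp add: open_fun_def)
      moreover have "rect_eval \<rho> \<in> V" using U V by blast
      ultimately obtain X where X: "rect_eval \<rho> \<in> Pi\<^sub>E UNIV X" "finite {i. X i \<noteq> UNIV}" "Pi\<^sub>E UNIV X \<subseteq> V"
        using product_topology_open_contains_basis[of "\<lambda>i. euclideanreal" UNIV V "rect_eval \<rho>"]
        unfolding topspace_euclidean by blast
      let ?F = "{i. X i \<noteq> UNIV}"
      \<comment> \<open>Non-measurable sides may be discarded: \<open>rect_eval\<close> gives 0 to
        such a pair for every coupling.\<close>
      define \<E> where "\<E> = (fst ` ?F \<union> snd ` ?F) \<inter> sets Ylam"
      have "finite \<E>"
        unfolding \<E>_def by (intro finite_Int disjI1 finite_UnI finite_imageI X(2))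
      then obtain E and n :: nat where E: "\<E> = E ` {i. i < n}"
        unfolding finite_conv_nat_seg_image by blast
      have "\<exists>S\<in>Aut Ylam. \<forall>i<n. \<forall>j<n. measure (graph_coupling S) (E i \<times> E j) = measure \<rho> (E i \<times> E j)"
        by (rule realize_coupling_on_finite_family[OF \<rho>]) (use E \<E>_def in blast)
      then obtain S where S: "S \<in> Aut Ylam"
        "\<And>i j. i < n \<Longrightarrow> j < n \<Longrightarrow> measure (graph_coupling S) (E i \<times> E j) = measure \<rho> (E i \<times> E j)"
        by blast
      have "rect_eval (graph_coupling S) (A, B) = rect_eval \<rho> (A, B)" if "(A, B) \<in> ?F" for A B
      proof (cases "A \<in> sets Ylam \<and> B \<in> sets Ylam")
        case True
        have "A \<in> fst ` ?F" "B \<in> snd ` ?F" using that by force+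
        then have "A \<in> E ` {i. i < n}" "B \<in> E ` {i. i < n}"
          using True E \<E>_def by blast+
        then show ?thesis using S(2) True by (auto simp: rect_eval_def)
      qed (auto simp: rect_eval_def)
      then have "rect_eval (graph_coupling S) i \<in> X i" for i
        using X(1) by (cases "X i = UNIV"; cases i) (auto simp: PiE_def Pi_def)
      then have "rect_eval (graph_coupling S) \<in> V" using X(3) by (auto simp: PiE_def Pi_def)
      moreover have "graph_coupling S \<in> AutC2" using S by (simp add: AutC2_def)
      ultimately show ?thesis using V AutC2_subset by blast
    qed
    then show "\<rho> \<in> C2_top closure_of AutC2" unfolding in_closure_of using \<rho> by auto
  qed
qed

section \<open>The shift, the lens map and conjugation of graph couplings\<close>

lemma shift_mp_iso: "mp_iso Ylam Ylam shiftT (\<lambda>y n. y (n - 1))"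
proof -
  have mp: "(\<lambda>y n. y (n + k)) \<in> measure_preserving Ylam Ylam" for k :: int
  proof -
    have "distr (Pi\<^sub>M UNIV (\<lambda>i. circ)) (\<Pi>\<^sub>M i\<in>UNIV. circ) (\<lambda>\<omega>. \<lambda>n\<in>UNIV. \<omega> (n + k)) = (\<Pi>\<^sub>M i\<in>(UNIV::int set). circ)"
      by (rule distr_PiM_reindex[of UNIV "\<lambda>_. circ" "\<lambda>n. n + k" UNIV]) (auto simp: prob_space_circ)
    moreover have "(\<lambda>y n. y (n + k)) \<in> Ylam \<rightarrow>\<^sub>M Ylam"
      by (rule measurable_into_Ylam) (rule measurable_Ylam_component')
    ultimately show ?thesis by (simp add: measure_preserving_iff Ylam_def restrict_UNIV)
  qed
  have "shiftT = (\<lambda>y n. y (n + 1))" by (auto simp: shiftT_def)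
  then show ?thesis unfolding mp_iso_def using mp[of 1] mp[of "-1"] by (simp add: shiftT_def)
qed

lemma shift_mp: "shiftT \<in> measure_preserving Ylam Ylam"
  using shift_mp_iso by (simp add: mp_iso_def)

lemma lens_measurable:
  assumes T: "T \<in> Ylam \<rightarrow>\<^sub>M Ylam"
  shows "(\<lambda>(x, y). (T x, T y)) \<in> Ylam \<Otimes>\<^sub>M Ylam \<rightarrow>\<^sub>M Ylam \<Otimes>\<^sub>M Ylam"
  unfolding case_prod_beta
  by (intro measurable_Pair measurable_compose[OF measurable_fst T] measurable_compose[OF measurable_snd T])

lemma measure_lensT:
  assumes \<rho>: "\<rho> \<in> C2" and T: "T \<in> Ylam \<rightarrow>\<^sub>M Ylam" and AB: "A \<in> sets Ylam" "B \<in> sets Ylam"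
  shows "measure (lensT T \<rho>) (A \<times> B) = measure \<rho> ((T -` A \<inter> space Ylam) \<times> (T -` B \<inter> space Ylam))"
proof -
  have sets: "sets \<rho> = sets (Ylam \<Otimes>\<^sub>M Ylam)" using \<rho> by (simp add: C2_iff)
  have m: "(\<lambda>(x, y). (T x, T y)) \<in> \<rho> \<rightarrow>\<^sub>M Ylam \<Otimes>\<^sub>M Ylam"
    using lens_measurable[OF T] measurable_cong_sets[OF sets refl] by blast
  have "A \<times> B \<in> sets (Ylam \<Otimes>\<^sub>M Ylam)" using AB by simp
  then show ?thesis
    unfolding lensT_def using measure_distr[OF m] sets_eq_imp_space_eq[OF sets]
    by (auto simp: space_pair_measure intro!: arg_cong[where f="measure \<rho>"])
qed

lemma lensT_in_C2:
  assumes \<rho>: "\<rho> \<in> C2" and T: "T \<in> measure_preserving Ylam Ylam"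
  shows "lensT T \<rho> \<in> C2"
proof -
  have sets: "sets \<rho> = sets (Ylam \<Otimes>\<^sub>M Ylam)" using \<rho> by (simp add: C2_iff)
  interpret r: prob_space \<rho> using \<rho> by (simp add: C2_iff)
  have m: "(\<lambda>(x, y). (T x, T y)) \<in> \<rho> \<rightarrow>\<^sub>M Ylam \<Otimes>\<^sub>M Ylam"
    using lens_measurable[OF measure_preserving_measurable[OF T]] measurable_cong_sets[OF sets refl] by blast
  have "distr (lensT T \<rho>) Ylam fst = distr \<rho> Ylam (\<lambda>z. T (fst z))"
    unfolding lensT_def by (subst distr_distr[OF measurable_fst m]) (simp add: comp_def case_prod_beta)
  moreover have "distr (lensT T \<rho>) Ylam snd = distr \<rho> Ylam (\<lambda>z. T (snd z))"
    unfolding lensT_def by (subst distr_distr[OF measurable_snd m]) (simp add: comp_def case_prod_beta)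
  moreover have "(\<lambda>z. T (fst z)) \<in> measure_preserving \<rho> Ylam" "(\<lambda>z. T (snd z)) \<in> measure_preserving \<rho> Ylam"
    using \<rho> measure_preserving_comp[OF _ T] unfolding C2_iff by blast+
  ultimately show ?thesis
    unfolding C2_def using r.prob_space_distr[OF m]
    by (simp add: measure_preserving_distr) (simp add: lensT_def)
qed

lemma continuous_map_lensT:
  assumes T: "T \<in> measure_preserving Ylam Ylam"
  shows "continuous_map C2_top C2_top (lensT T)"
proof (rule continuous_map_into_C2)
  note Tm = measure_preserving_measurable[OF T]
  show "lensT T ` topspace C2_top \<subseteq> C2" using lensT_in_C2 T by auto
  fix A B assume AB: "A \<in> sets Ylam" "B \<in> sets Ylam"
  have "continuous_map C2_top euclideanreal (\<lambda>\<rho>. measure \<rho> ((T -` A \<inter> space Ylam) \<times> (T -` B \<inter> space Ylam)))"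
    using measurable_sets[OF Tm] AB by (intro continuous_map_rect) auto
  then show "continuous_map C2_top euclideanreal (\<lambda>\<rho>. measure (lensT T \<rho>) (A \<times> B))"
    by (rule continuous_map_eq) (simp add: measure_lensT[OF _ Tm AB])
qed

text \<open>Formulated by intertwining, so that no inverse of \<open>T\<close> appears: almost
  surely \<open>(T (S y), T y)\<close> is \<open>(S' (T y), T y)\<close>, and \<open>T y\<close>
  again has law \<open>Ylam\<close>.\<close>

lemma lensT_graph_coupling:
  assumes T: "T \<in> measure_preserving Ylam Ylam" and S: "S \<in> Ylam \<rightarrow>\<^sub>M Ylam" and S': "S' \<in> Ylam \<rightarrow>\<^sub>M Ylam"
    and eq: "AE y in Ylam. T (S y) = S' (T y)"
  shows "lensT T (graph_coupling S) = graph_coupling S'"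
proof -
  note Tm = measure_preserving_measurable[OF T]
  have "lensT T (graph_coupling S) = distr Ylam (Ylam \<Otimes>\<^sub>M Ylam) (\<lambda>y. (T (S y), T y))"
    unfolding lensT_def graph_coupling_def
    by (subst distr_distr[OF lens_measurable[OF Tm] graph_measurable[OF S]]) (simp add: comp_def)
  also have "\<dots> = distr Ylam (Ylam \<Otimes>\<^sub>M Ylam) (\<lambda>y. (S' (T y), T y))"
    by (intro distr_cong_AE measurable_Pair measurable_compose[OF S Tm] measurable_compose[OF Tm S'] Tm refl)
       (use eq in auto)
  also have "\<dots> = distr (distr Ylam Ylam T) (Ylam \<Otimes>\<^sub>M Ylam) (\<lambda>y. (S' y, y))"
    using distr_distr[OF graph_measurable[OF S'] Tm] by (simp add: comp_def)
  finally show ?thesis by (simp add: measure_preserving_distr[OF T] graph_coupling_def)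
qed

text \<open>Conjugation by \<open>T\<close> gives invariance; conjugation by \<open>T'\<close> gives
  a preimage for each graph, hence equality.\<close>

lemma lensT_AutC2:
  assumes "mp_iso Ylam Ylam T T'"
  shows "lensT T ` AutC2 = AutC2"
proof -
  have T: "T \<in> measure_preserving Ylam Ylam" "T' \<in> measure_preserving Ylam Ylam"
    and TT: "AE y in Ylam. T' (T y) = y" "AE y in Ylam. T (T' y) = y"
    using assms by (auto simp: mp_iso_def)
  have *: "lensT T (graph_coupling S) \<in> AutC2" "graph_coupling S \<in> lensT T ` AutC2" if S: "S \<in> Aut Ylam" for S
  proof -
    obtain S' where iS: "mp_iso Ylam Ylam S S'" using S by (auto simp: Aut_iff_mp_iso)
    then have Smp: "S \<in> measure_preserving Ylam Ylam" by (simp add: mp_iso_def)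
    have c1: "(\<lambda>y. T (S (T' y))) \<in> Aut Ylam"
      unfolding Aut_iff_mp_iso using mp_iso_comp[OF mp_iso_comp[OF mp_iso_sym[OF assms] iS] assms] by blast
    have c2: "(\<lambda>y. T' (S (T y))) \<in> Aut Ylam"
      unfolding Aut_iff_mp_iso using mp_iso_comp[OF mp_iso_comp[OF assms iS] mp_iso_sym[OF assms]] by blast
    have m: "S \<in> Ylam \<rightarrow>\<^sub>M Ylam" "(\<lambda>y. T (S (T' y))) \<in> Ylam \<rightarrow>\<^sub>M Ylam" "(\<lambda>y. T' (S (T y))) \<in> Ylam \<rightarrow>\<^sub>M Ylam"
      using S c1 c2 by (auto simp: Aut_def intro: measure_preserving_measurable)
    have "lensT T (graph_coupling S) = graph_coupling (\<lambda>y. T (S (T' y)))"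
      by (rule lensT_graph_coupling[OF T(1) m(1) m(2)]) (use TT(1) in \<open>eventually_elim, simp\<close>)
    then show "lensT T (graph_coupling S) \<in> AutC2" using c1 by (simp add: AutC2_def)
    have "lensT T (graph_coupling (\<lambda>y. T' (S (T y)))) = graph_coupling S"
      by (rule lensT_graph_coupling[OF T(1) m(3) m(1)])
         (rule AE_measure_preserving[OF measure_preserving_comp[OF T(1) Smp] TT(2)])
    moreover have "graph_coupling (\<lambda>y. T' (S (T y))) \<in> AutC2" using c2 by (simp add: AutC2_def)
    ultimately show "graph_coupling S \<in> lensT T ` AutC2" by force
  qed
  show ?thesis
  proof
    show "lensT T ` AutC2 \<subseteq> AutC2" using *(1) unfolding AutC2_def by auto
    show "AutC2 \<subseteq> lensT T ` AutC2"
    proof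
      fix \<rho> assume "\<rho> \<in> AutC2"
      then obtain S where "S \<in> Aut Ylam" "\<rho> = graph_coupling S" unfolding AutC2_def by blast
      then show "\<rho> \<in> lensT T ` AutC2" using *(2) by simp
    qed
  qed
qed

section \<open>Convergence of graph couplings\<close>

text \<open>A generator closed under intersection for which membership is stable under
  coordinatewise limits, unless the limit lies on one of the finitely many boundaries
  \<open>y i = a i\<close>.\<close>

definition orthants :: "pt set set" where
  "orthants = {{y \<in> space Ylam. \<forall>i\<in>F. y i \<le> a i} |F a. finite F}"

lemma Int_stable_orthants: "Int_stable orthants"
proof (rule Int_stableI)
  fix A B assume "A \<in> orthants" "B \<in> orthants"
  then obtain F a G b where A: "A = {y \<in> space Ylam. \<forall>i\<in>F. y i \<le> a i}" "finite F"
    and B: "B = {y \<in> space Ylam. \<forall>i\<in>G. y i \<le> b i}" "finite G"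
    unfolding orthants_def by blast
  define c where "c i = (if i \<in> F then if i \<in> G then min (a i) (b i) else a i else b i)" for i
  have "A \<inter> B = {y \<in> space Ylam. \<forall>i\<in>F \<union> G. y i \<le> c i}"
    unfolding A B c_def by auto
  then show "A \<inter> B \<in> orthants" unfolding orthants_def using A B by blast
qed

lemma sets_Ylam_orthants: "sets Ylam = sigma_sets (space Ylam) orthants"
proof
  have sub: "orthants \<subseteq> sets Ylam"
  proof
    fix A assume "A \<in> orthants"
    then obtain F a where A: "A = {y \<in> space Ylam. \<forall>i\<in>F. y i \<le> a i}" "finite F"
      unfolding orthants_def by blast
    have "{y \<in> space Ylam. y i \<le> a i} \<in> sets Ylam" for i
      using measurable_Ylam_component[of i] unfolding borel_measurable_iff_le by blast
    then show "A \<in> sets Ylam" unfolding A using A(2) by (intro sets.sets_Collect_finite_All) auto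
  qed
  then show "sigma_sets (space Ylam) orthants \<subseteq> sets Ylam" by (rule sets.sigma_sets_subset)
  let ?N = "sigma (space Ylam) orthants"
  have pow: "orthants \<subseteq> Pow (space Ylam)" unfolding orthants_def by auto
  have N: "space ?N = space Ylam" "sets ?N = sigma_sets (space Ylam) orthants" using pow by simp_all
  have "(\<lambda>y. y) \<in> ?N \<rightarrow>\<^sub>M Ylam"
  proof (rule measurable_into_Ylam)
    fix n
    have "{y \<in> space ?N. y n \<le> a} \<in> sets ?N" for a
    proof -
      have "{y \<in> space Ylam. y n \<le> a} \<in> orthants"
        unfolding orthants_def by (intro CollectI exI[of _ "{n}"] exI[of _ "\<lambda>_. a"]) simp
      then show ?thesis unfolding N by (rule sigma_sets.Basic)
    qed
    moreover have "\<forall>y\<in>space ?N. 0 \<le> y n \<and> y n < 1"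
    proof
      fix y assume "y \<in> space ?N"
      then have "y \<in> space Ylam" unfolding N(1) .
      then show "0 \<le> y n \<and> y n < 1" by (simp add: space_Ylam)
    qed
    ultimately show "(\<lambda>y. y n) \<in> ?N \<rightarrow>\<^sub>M circ"
      unfolding measurable_circ_iff borel_measurable_iff_le by blast
  qed
  then have "A \<in> sets ?N" if "A \<in> sets Ylam" for A
    using measurable_sets[of "\<lambda>y. y" ?N Ylam A] that sets.sets_into_space[OF that] N(1)
    by (simp add: Int_absorb2)
  then show "sets Ylam \<subseteq> sigma_sets (space Ylam) orthants" using N by blast
qed

text \<open>The \<open>\<pi>\<close>-\<open>\<lambda>\<close> argument goes through because measure preservation bounds the tails of a disjoint
  union uniformly in \<open>k\<close>.\<close>

lemma graph_coupling_tendsto: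
  fixes S :: "nat \<Rightarrow> pt \<Rightarrow> pt"
  assumes S: "\<And>k. S k \<in> measure_preserving Ylam Ylam" and S0: "S0 \<in> measure_preserving Ylam Ylam"
    and lim: "\<And>i. AE y in Ylam. (\<lambda>k. S k y i) \<longlonglongrightarrow> S0 y i"
    and B: "B \<in> sets Ylam" and A: "A \<in> sets Ylam"
  shows "(\<lambda>k. measure (graph_coupling (S k)) (A \<times> B)) \<longlonglongrightarrow> measure (graph_coupling S0) (A \<times> B)"
proof -
  note Sm = S[THEN measure_preserving_measurable] and S0m = measure_preserving_measurable[OF S0]
  \<comment> \<open>The side \<open>B\<close> stays fixed throughout; the induction over generators
    runs in \<open>A\<close> alone.\<close>
  define m where "m R A = measure Ylam {y \<in> space Ylam. R y \<in> A \<and> y \<in> B}" for R :: "pt \<Rightarrow> pt" and A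
  have ev: "{y \<in> space Ylam. R y \<in> A \<and> y \<in> B} \<in> sets Ylam" if R: "R \<in> Ylam \<rightarrow>\<^sub>M Ylam" and A: "A \<in> sets Ylam" for R A
  proof -
    have "{y \<in> space Ylam. R y \<in> A \<and> y \<in> B} = (R -` A \<inter> space Ylam) \<inter> B"
      using sets.sets_into_space[OF B] by auto
    then show ?thesis using measurable_sets[OF R A] B by simp
  qed
  have mle: "m R A \<le> measure Ylam A" if R: "R \<in> measure_preserving Ylam Ylam" and A: "A \<in> sets Ylam" for R A
  proof -
    have Rm: "R \<in> Ylam \<rightarrow>\<^sub>M Ylam" using R by (rule measure_preserving_measurable)
    have "m R A \<le> measure Ylam (R -` A \<inter> space Ylam)"
      unfolding m_def using measurable_sets[OF Rm A] by (intro Y.finite_measure_mono) auto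
    also have "\<dots> = measure Ylam A" using R A by (simp add: measure_preserving_def measure_def)
    finally show ?thesis .
  qed
  have pow: "orthants \<subseteq> Pow (space Ylam)" unfolding orthants_def by auto
  have "A \<in> sigma_sets (space Ylam) orthants" using A sets_Ylam_orthants by simp
  with Int_stable_orthants pow have "(\<lambda>k. m (S k) A) \<longlonglongrightarrow> m S0 A"
  proof (induction rule: sigma_sets_induct_disjoint)
    case (basic A)
    then obtain F a where A: "A = {y \<in> space Ylam. \<forall>i\<in>F. y i \<le> a i}" and F: "finite F"
      unfolding orthants_def by blast
    have As: "A \<in> sets Ylam" using basic sets_Ylam_orthants by auto
    \<comment> \<open>Comparison with \<open>a i\<close> can fail to settle only where the limit
      equals \<open>a i\<close>. This is a null event because \<open>S0\<close> preserves
      \<open>Ylam\<close> and \<open>circ\<close> has no atoms.\<close>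
    have ne: "AE y in Ylam. S0 y i \<noteq> a i" for i
    proof -
      have "AE t in lborel. t \<noteq> a i" by (rule AE_lborel_singleton)
      then have "AE t in circ. t \<noteq> a i" unfolding circ_def by (subst AE_restrict_space_iff) auto
      then show ?thesis
        by (rule AE_measure_preserving[OF measure_preserving_comp[OF S0 component_measure_preserving]])
    qed
    have AEall: "AE y in Ylam. \<forall>i. (\<lambda>k. S k y i) \<longlonglongrightarrow> S0 y i \<and> S0 y i \<noteq> a i"
      unfolding AE_all_countable using lim ne by auto
    have "(\<lambda>k. \<integral>y. indicator {y \<in> space Ylam. S k y \<in> A \<and> y \<in> B} y \<partial>Ylam)
        \<longlonglongrightarrow> (\<integral>y. indicator {y \<in> space Ylam. S0 y \<in> A \<and> y \<in> B} y \<partial>Ylam :: real)"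
    proof (rule integral_dominated_convergence[where w="\<lambda>_. 1"])
      show "AE y in Ylam. (\<lambda>k. indicator {y \<in> space Ylam. S k y \<in> A \<and> y \<in> B} y)
          \<longlonglongrightarrow> (indicator {y \<in> space Ylam. S0 y \<in> A \<and> y \<in> B} y :: real)"
      proof (rule AE_mp[OF AEall], intro AE_I2 impI)
        fix y assume y: "y \<in> space Ylam" and *: "\<forall>i. (\<lambda>k. S k y i) \<longlonglongrightarrow> S0 y i \<and> S0 y i \<noteq> a i"
        have "\<forall>\<^sub>F k in sequentially. S k y i \<le> a i \<longleftrightarrow> S0 y i \<le> a i" for i
        proof (cases "S0 y i < a i")
          case True
          then have "\<forall>\<^sub>F k in sequentially. S k y i < a i" using * by (intro order_tendstoD(2)) auto
          then show ?thesis by eventually_elim (use True in auto)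
        next
          case False
          then have "\<forall>\<^sub>F k in sequentially. a i < S k y i" using * by (intro order_tendstoD(1)) (auto simp: less_le)
          then show ?thesis by eventually_elim (use False * in \<open>auto simp: less_le\<close>)
        qed
        then have "\<forall>\<^sub>F k in sequentially. \<forall>i\<in>F. S k y i \<le> a i \<longleftrightarrow> S0 y i \<le> a i"
          using F by (intro eventually_ball_finite) auto
        then have "\<forall>\<^sub>F k in sequentially. S k y \<in> A \<longleftrightarrow> S0 y \<in> A"
          by eventually_elim (use measurable_space[OF Sm y] measurable_space[OF S0m y] in \<open>auto simp: A\<close>)
        then have "\<forall>\<^sub>F k in sequentially. indicator {y \<in> space Ylam. S k y \<in> A \<and> y \<in> B} y
            = (indicator {y \<in> space Ylam. S0 y \<in> A \<and> y \<in> B} y :: real)"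
          by eventually_elim (simp add: indicator_def)
        then show "(\<lambda>k. indicator {y \<in> space Ylam. S k y \<in> A \<and> y \<in> B} y)
          \<longlonglongrightarrow> (indicator {y \<in> space Ylam. S0 y \<in> A \<and> y \<in> B} y :: real)"
          by (rule tendsto_eventually)
      qed
    qed (use ev[OF Sm As] ev[OF S0m As] in \<open>auto simp: indicator_def[abs_def] intro!: borel_measurable_indicator\<close>)
    moreover have "{y \<in> space Ylam. R y \<in> A \<and> y \<in> B} \<inter> space Ylam = {y \<in> space Ylam. R y \<in> A \<and> y \<in> B}" for R :: "pt \<Rightarrow> pt"
      by auto
    ultimately show ?case unfolding m_def by simp
  next
    case empty
    show ?case by (simp add: m_def)
  next
    case (compl A)
    have As: "A \<in> sets Ylam" using compl sets_Ylam_orthants by auto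
    have "m R (space Ylam - A) = measure Ylam B - m R A" if R: "R \<in> Ylam \<rightarrow>\<^sub>M Ylam" for R
    proof -
      have "{y \<in> space Ylam. R y \<in> space Ylam - A \<and> y \<in> B} = B - {y \<in> space Ylam. R y \<in> A \<and> y \<in> B}"
        using sets.sets_into_space[OF B] measurable_space[OF R] by auto
      then show ?thesis unfolding m_def
        by (simp only:) (rule Y.finite_measure_Diff[OF B ev[OF R As]], auto)
    qed
    then show ?case using compl.IH Sm S0m by (auto intro!: tendsto_diff)
  next
    case (union A)
    have As: "A i \<in> sets Ylam" for i using union sets_Ylam_orthants by auto
    have sums: "(\<lambda>i. m R (A i)) sums m R (\<Union>i. A i)" if R: "R \<in> Ylam \<rightarrow>\<^sub>M Ylam" for R
    proof -
      have "(\<lambda>i. m R (A i)) sums measure Ylam (\<Union>i. {y \<in> space Ylam. R y \<in> A i \<and> y \<in> B})"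
        unfolding m_def
        by (rule Y.finite_measure_UNION) (use ev[OF R As] union.hyps in \<open>auto simp: disjoint_family_on_def\<close>)
      also have "(\<Union>i. {y \<in> space Ylam. R y \<in> A i \<and> y \<in> B}) = {y \<in> space Ylam. R y \<in> (\<Union>i. A i) \<and> y \<in> B}" by auto
      finally show ?thesis unfolding m_def .
    qed
    have "(\<lambda>i. measure Ylam (A i)) sums measure Ylam (\<Union>i. A i)"
      by (rule Y.finite_measure_UNION) (use As union.hyps in auto)
    then have summ: "summable (\<lambda>i. measure Ylam (A i))" by (rule sums_summable)
    have "(\<lambda>k. \<Sum>i. m (S k) (A i)) \<longlonglongrightarrow> (\<Sum>i. m S0 (A i))"
    proof -
      have "\<forall>\<^sub>F (i, k) in sequentially \<times>\<^sub>F sequentially. norm (m (S k) (A i)) \<le> measure Ylam (A i)"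
        by (rule always_eventually) (use mle[OF S As] in \<open>auto simp: m_def\<close>)
      from tannerys_theorem[OF union.IH this summ] show ?thesis by simp
    qed
    then show ?case using sums_unique[OF sums[OF Sm]] sums_unique[OF sums[OF S0m]] by simp
  qed
  then show ?thesis unfolding m_def using measure_graph_coupling[OF Sm A B] measure_graph_coupling[OF S0m A B] by simp
qed

text \<open>Cut the preimage of \<open>A\<close> according to the displacement \<open>q\<close>.
  Each part \<open>P q\<close> is translated onto \<open>P' q\<close>, which preserves Lebesgue
  measure; injectivity of \<open>h\<close> keeps the translates disjoint, surjectivity makes them
  exhaust \<open>A\<close>, and countability of \<open>Q\<close> allows summation.\<close>

lemma circ_piecewise_translation_mp:
  assumes h: "h \<in> circ \<rightarrow>\<^sub>M circ" and inj: "inj_on h {0..<1}" and surj: "h ` {0..<1} = {0..<1}"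
    and Q: "countable Q" "\<And>t. t \<in> {0..<1} \<Longrightarrow> h t - t \<in> Q"
  shows "h \<in> measure_preserving circ circ"
  unfolding measure_preserving_def
proof (intro CollectI conjI h ballI)
  fix A assume A: "A \<in> sets circ"
  define X where "X = h -` A \<inter> space circ"
  have X: "X \<in> sets circ" unfolding X_def using h A by (rule measurable_sets)
  have hb: "h \<in> borel_measurable circ" using h by (simp add: measurable_circ_iff)
  have idb: "(\<lambda>t. t) \<in> borel_measurable circ" using measurable_circ_iff[of "\<lambda>t. t" circ] by (auto intro: measurable_ident_sets)
  define P where "P q = {t \<in> X. h t - t = q}" for q
  define P' where "P' q = (\<lambda>a. a - q) -` P q" for q
  have Pc: "P q \<in> sets circ" for q
  proof -
    have "P q = X \<inter> {t \<in> space circ. h t - t = q}" using sets.sets_into_space[OF X] unfolding P_def by auto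
    moreover have "{t \<in> space circ. h t - t = q} \<in> sets circ"
      by (intro borel_measurable_eq borel_measurable_diff hb idb) simp
    ultimately show ?thesis using X by simp
  qed
  have Pb: "P q \<in> sets borel" "P' q \<in> sets borel" for q
  proof -
    show 1: "P q \<in> sets borel" using Pc by (simp add: sets_circ)
    have "(\<lambda>a. a - q) -` P q \<inter> space borel \<in> sets borel"
      by (rule measurable_sets[OF _ 1]) simp
    then show "P' q \<in> sets borel" unfolding P'_def by simp
  qed
  have tr: "emeasure lborel (P q) = emeasure lborel (P' q)" for q
  proof -
    have "emeasure lborel (P' q) = emeasure (distr lborel borel ((+) q)) (P' q)" by (simp only: lborel_distr_plus)
    also have "\<dots> = emeasure lborel ((+) q -` P' q \<inter> space lborel)" using Pb by (intro emeasure_distr) auto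
    also have "(+) q -` P' q \<inter> space lborel = P q" by (auto simp: P'_def)
    finally show ?thesis by simp
  qed
  have XP: "X = \<Union> (P ` Q)" using Q(2) X_def by (auto simp: P_def)
  have AP: "A = \<Union> (P' ` Q)"
  proof (intro equalityI subsetI)
    fix a assume a: "a \<in> A"
    then have "a \<in> h ` {0..<1}" using sets.sets_into_space[OF A] surj by auto
    then obtain t where t: "t \<in> {0..<1}" "a = h t" by blast
    then have "t \<in> P (h t - t)" using a by (auto simp: P_def X_def)
    then have "a \<in> P' (h t - t)" using t by (simp add: P'_def)
    then show "a \<in> \<Union> (P' ` Q)" using Q(2)[OF t(1)] by blast
  next
    fix a assume "a \<in> \<Union> (P' ` Q)"
    then obtain q where "a - q \<in> P q" by (auto simp: P'_def)
    then show "a \<in> A" by (auto simp: P_def X_def)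
  qed
  have "emeasure lborel X = (\<integral>\<^sup>+q. emeasure lborel (P q) \<partial>count_space Q)"
    unfolding XP by (rule emeasure_UN_countable) (use Q Pb in \<open>auto simp: disjoint_family_on_def P_def\<close>)
  also have "\<dots> = (\<integral>\<^sup>+q. emeasure lborel (P' q) \<partial>count_space Q)" by (simp add: tr)
  also have "\<dots> = emeasure lborel A"
    unfolding AP
  proof (rule emeasure_UN_countable[symmetric])
    show "disjoint_family_on P' Q"
      unfolding disjoint_family_on_def
    proof (intro ballI impI equals0I)
      fix q r a assume "q \<noteq> r" "a \<in> P' q \<inter> P' r"
      then have "a - q \<in> P q" "a - r \<in> P r" by (auto simp: P'_def)
      then have "h (a - q) = a" "h (a - r) = a" "a - q \<in> {0..<1}" "a - r \<in> {0..<1}"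
        by (auto simp: P_def X_def)
      then have "a - q = a - r" using inj_onD[OF inj, of "a - q" "a - r"] by simp
      then show False using \<open>q \<noteq> r\<close> by simp
    qed
  qed (use Q Pb in auto)
  finally show "emeasure circ (h -` A \<inter> space circ) = emeasure circ A"
    using emeasure_circ[OF X] emeasure_circ[OF A] by (simp add: X_def)
qed

lemma product_map_mp:
  assumes f: "\<And>n. f n \<in> measure_preserving circ circ"
  shows "(\<lambda>y n. f n (y n)) \<in> measure_preserving Ylam Ylam"
proof -
  note fm = f[THEN measure_preserving_measurable]
  have m: "(\<lambda>y n. f n (y n)) \<in> Ylam \<rightarrow>\<^sub>M Ylam"
    by (rule measurable_into_Ylam) (rule measurable_compose[OF measurable_Ylam_component' fm])
  have "distr Ylam Ylam (\<lambda>y n. f n (y n)) = Ylam"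
  proof (rule measure_eqI_PiM_infinite[of _ UNIV "\<lambda>_. circ"])
    fix A :: "int \<Rightarrow> real set" and J :: "int set" assume J: "finite J" "J \<subseteq> UNIV" and A: "\<And>i. i \<in> J \<Longrightarrow> A i \<in> sets circ"
    let ?E = "\<lambda>A. prod_emb UNIV (\<lambda>_. circ) J (Pi\<^sub>E J A)"
    have E: "?E A = {y \<in> space Ylam. \<forall>i\<in>J. y i \<in> A i}" for A
      by (auto simp: prod_emb_def Ylam_def space_PiM)
    have "?E A \<in> sets Ylam" using J A unfolding Ylam_def by (intro sets_PiM_I) auto
    then have "emeasure (distr Ylam Ylam (\<lambda>y n. f n (y n))) (?E A)
        = emeasure Ylam ((\<lambda>y n. f n (y n)) -` ?E A \<inter> space Ylam)"
      by (rule emeasure_distr[OF m])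
    also have "(\<lambda>y n. f n (y n)) -` ?E A \<inter> space Ylam = ?E (\<lambda>i. f i -` A i \<inter> space circ)"
      unfolding E using measurable_space[OF m] by (auto simp: space_Ylam)
    also have "emeasure Ylam \<dots> = (\<Prod>i\<in>J. emeasure circ (f i -` A i \<inter> space circ))"
      unfolding Ylam_def using J A measurable_sets[OF fm] by (intro emeasure_PiM_emb prob_space_circ) auto
    also have "\<dots> = (\<Prod>i\<in>J. emeasure circ (A i))"
      using f A by (intro prod.cong) (auto simp: measure_preserving_def)
    also have "\<dots> = emeasure Ylam (?E A)"
      unfolding Ylam_def using J A by (intro emeasure_PiM_emb[symmetric] prob_space_circ) auto
    finally show "emeasure (distr Ylam Ylam (\<lambda>y n. f n (y n))) (?E A) = emeasure Ylam (?E A)" .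
  next
    show "finite_measure (distr Ylam Ylam (\<lambda>y n. f n (y n)))"
      using Y.prob_space_distr[OF m] by (rule prob_space.finite_measure)
  qed (simp_all add: Ylam_def)
  then show ?thesis using m by (simp add: measure_preserving_iff)
qed

section \<open>Coordinatewise piecewise rotations\<close>

text \<open>The endpoints 1 - 1/(j+1) are chosen so that 1/(1-t) runs through [j+1, j+2) on the
  \<open>j\<close>-th interval; the index is therefore a floor, lowered by one to start at
  0.\<close>

definition piece :: "real \<Rightarrow> nat" where "piece t = nat \<lfloor>1 / (1 - t)\<rfloor> - 1"
definition left :: "nat \<Rightarrow> real" where "left j = 1 - 1 / (real j + 1)"
definition len :: "nat \<Rightarrow> real" where "len j = 1 / ((real j + 1) * (real j + 2))"

text \<open>\<open>piece_rot c\<close> rotates the \<open>j\<close>-th of the consecutive intervals \<open>[1 - 1/(j+1), 1 - 1/(j+2))\<close> by the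
  proportion \<open>c j\<close> of its length.\<close>

definition piece_rot :: "(nat \<Rightarrow> real) \<Rightarrow> real \<Rightarrow> real" where
  "piece_rot c t = left (piece t) + len (piece t) * frac ((t - left (piece t)) / len (piece t) + c (piece t))"

lemma len_pos: "len j > 0"
  by (simp add: len_def)

lemma left_add_len: "left j + len j = 1 - 1 / (real j + 2)"
proof -
  have "1 / a - 1 / (a * (a + 1)) = 1 / (a + 1)" if "a > 0" for a :: real
    using that by (simp add: divide_simps)
  from this[of "real j + 1"] show ?thesis by (simp add: left_def len_def add.assoc)
qed

lemma piece_eq_iff:
  assumes "0 \<le> t" "t < 1"
  shows "piece t = j \<longleftrightarrow> left j \<le> t \<and> t < left j + len j"
proof -
  have "1 / (1 - t) \<ge> 1" using assms by (simp add: field_simps)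
  then have fl: "\<lfloor>1 / (1 - t)\<rfloor> \<ge> 1" by linarith
  then have "piece t = j \<longleftrightarrow> \<lfloor>1 / (1 - t)\<rfloor> = int j + 1" unfolding piece_def by linarith
  also have "\<dots> \<longleftrightarrow> real j + 1 \<le> 1 / (1 - t) \<and> 1 / (1 - t) < real j + 2"
    by (simp add: floor_eq_iff add.commute)
  also have "real j + 1 \<le> 1 / (1 - t) \<longleftrightarrow> left j \<le> t"
    using assms by (simp add: left_def field_simps)
  also have "1 / (1 - t) < real j + 2 \<longleftrightarrow> t < left j + len j"
    unfolding left_add_len using assms by (simp add: field_simps)
  finally show ?thesis .
qed

lemma left_bounds: "0 \<le> left j" "left j + len j < 1"
  unfolding left_add_len by (simp_all add: left_def field_simps)

lemma in_piece:
  assumes "0 \<le> s" "s < 1"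
  shows "0 \<le> left j + len j * s" "left j + len j * s < 1" "piece (left j + len j * s) = j"
proof -
  have "0 \<le> len j * s" "len j * s < len j" using assms len_pos[of j] by simp_all
  then show 1: "0 \<le> left j + len j * s" "left j + len j * s < 1" using left_bounds[of j] by linarith+
  show "piece (left j + len j * s) = j"
    using piece_eq_iff[OF 1, of j] \<open>0 \<le> len j * s\<close> \<open>len j * s < len j\<close> by simp
qed

lemma piece_coordinate:
  assumes "0 \<le> t" "t < 1"
  obtains s where "0 \<le> s" "s < 1" "t = left (piece t) + len (piece t) * s"
proof
  let ?j = "piece t"
  have "left ?j \<le> t" "t < left ?j + len ?j" using piece_eq_iff[OF assms, of ?j] by auto
  then show "0 \<le> (t - left ?j) / len ?j" "(t - left ?j) / len ?j < 1" "t = left ?j + len ?j * ((t - left ?j) / len ?j)"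
    using len_pos[of ?j] by (simp_all add: field_simps)
qed

lemma piece_rot_eq:
  assumes "0 \<le> s" "s < 1"
  shows "piece_rot c (left j + len j * s) = left j + len j * frac (s + c j)"
  using in_piece[OF assms, of j] len_pos[of j] by (simp add: piece_rot_def)

lemma piece_rot_range:
  assumes "0 \<le> t" "t < 1"
  shows "0 \<le> piece_rot c t" "piece_rot c t < 1"
  using in_piece[OF frac_ge_0 frac_lt_1] by (simp_all add: piece_rot_def)

lemma piece_rot_inverse:
  assumes "0 \<le> t" "t < 1"
  shows "piece_rot (\<lambda>j. - c j) (piece_rot c t) = t"
proof -
  obtain s where s: "0 \<le> s" "s < 1" "t = left (piece t) + len (piece t) * s" using piece_coordinate assms by blast
  define j where "j = piece t"
  have t: "t = left j + len j * s" using s j_def by simp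
  have "frac (frac (s + c j) + - c j) = s"
    unfolding frac_unique_iff using s by (simp add: frac_def)
  then show ?thesis
    unfolding t piece_rot_eq[OF s(1,2)] piece_rot_eq[OF frac_ge_0 frac_lt_1] by simp
qed

lemma measurable_piece_rot: "piece_rot c \<in> circ \<rightarrow>\<^sub>M circ"
proof -
  have [measurable]: "frac \<in> borel_measurable (borel :: real measure)" unfolding frac_def by measurable
  have f: "(\<lambda>t. left j + len j * frac ((t - left j) / len j + c j)) \<in> borel_measurable borel" for j
    by measurable
  have p: "piece \<in> borel \<rightarrow>\<^sub>M count_space UNIV" unfolding piece_def by measurable
  have "piece_rot c \<in> borel_measurable borel"
    unfolding piece_rot_def using measurable_compose_countable[OF f p] .
  then have "piece_rot c \<in> borel_measurable circ"
    unfolding circ_def by (intro measurable_restrict_space1) simp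
  then show ?thesis unfolding measurable_circ_iff using piece_rot_range by simp
qed

lemma piece_rot_mp: "piece_rot c \<in> measure_preserving circ circ"
proof (rule circ_piecewise_translation_mp[OF measurable_piece_rot])
  have inv: "piece_rot (\<lambda>j. - c j) (piece_rot c t) = t" if "t \<in> {0..<1}" for t c
    using piece_rot_inverse that by simp
  show "inj_on (piece_rot c) {0..<1}" by (rule inj_on_inverseI) (rule inv)
  show "piece_rot c ` {0..<1} = {0..<1}"
  proof
    show "piece_rot c ` {0..<1} \<subseteq> {0..<1}" using piece_rot_range by auto
    show "{0..<1} \<subseteq> piece_rot c ` {0..<1}"
    proof
      fix t :: real assume t: "t \<in> {0..<1}"
      have "t = piece_rot c (piece_rot (\<lambda>j. - c j) t)" using inv[OF t, of "\<lambda>j. - c j"] by simp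
      moreover have "piece_rot (\<lambda>j. - c j) t \<in> {0..<1}" using piece_rot_range t by simp
      ultimately show "t \<in> piece_rot c ` {0..<1}" by blast
    qed
  qed
  \<comment> \<open>On piece \<open>j\<close> the displacement is \<open>len j * c j\<close> minus
    \<open>len j\<close> times the integer part \<open>m\<close> removed by
    \<open>frac\<close>.\<close>
  let ?Q = "(\<lambda>(j, m). len j * (c j - of_int m)) ` (UNIV :: (nat \<times> int) set)"
  show "countable ?Q" by simp
  fix t :: real assume "t \<in> {0..<1}"
  then obtain s where s: "0 \<le> s" "s < 1" "t = left (piece t) + len (piece t) * s" using piece_coordinate[of t] by auto
  define j where "j = piece t"
  have t: "t = left j + len j * s" using s j_def by simp
  have "piece_rot c t - t = len j * (c j - of_int \<lfloor>s + c j\<rfloor>)"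
    unfolding t piece_rot_eq[OF s(1,2)] by (simp add: frac_def algebra_simps)
  then show "piece_rot c t - t \<in> ?Q" by (auto intro!: image_eqI[of _ _ "(j, \<lfloor>s + c j\<rfloor>)"])
qed

lemma AE_circ_countable:
  assumes "countable C"
  shows "AE t in circ. t \<notin> C"
proof -
  have "AE t in lborel. t \<notin> C"
    using countable_imp_null_set_lborel[OF assms] by (rule AE_not_in)
  then show ?thesis unfolding circ_def by (subst AE_restrict_space_iff) auto
qed

text \<open>\<open>frac\<close> is continuous off the integers. The points whose rotated position
  under \<open>c0\<close> hits an integer form a countable set, at most one for each piece and each
  integer.\<close>

lemma piece_rot_tendsto:
  assumes lim: "\<And>j. (\<lambda>k. c k j) \<longlonglongrightarrow> c0 j"
  shows "AE t in circ. (\<lambda>k. piece_rot (c k) t) \<longlonglongrightarrow> piece_rot c0 t"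
proof -
  let ?C = "(\<lambda>(j, m). left j + len j * (of_int m - c0 j)) ` (UNIV :: (nat \<times> int) set)"
  have "AE t in circ. t \<notin> ?C" by (rule AE_circ_countable) simp
  then show ?thesis
  proof (rule AE_mp, intro AE_I2 impI)
    fix t :: real assume "t \<in> space circ" and nC: "t \<notin> ?C"
    define j where "j = piece t"
    define x where "x = (t - left j) / len j"
    have x: "t = left j + len j * x" using len_pos[of j] by (simp add: x_def)
    have "x + c0 j \<notin> \<int>"
    proof
      assume "x + c0 j \<in> \<int>"
      then obtain m where "x + c0 j = of_int m" by (auto elim: Ints_cases)
      then have x': "x = of_int m - c0 j" by linarith
      have "t = left j + len j * (of_int m - c0 j)" using x by (simp only: x')
      then show False using nC by (auto intro!: image_eqI[of _ _ "(j, m)"])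
    qed
    then have "isCont frac (x + c0 j)" by (rule continuous_frac)
    moreover have "(\<lambda>k. x + c k j) \<longlonglongrightarrow> x + c0 j" by (intro tendsto_intros lim)
    ultimately have "(\<lambda>k. frac (x + c k j)) \<longlonglongrightarrow> frac (x + c0 j)" by (rule isCont_tendsto_compose)
    then show "(\<lambda>k. piece_rot (c k) t) \<longlonglongrightarrow> piece_rot c0 t"
      unfolding piece_rot_def j_def[symmetric] x_def[symmetric] by (intro tendsto_intros)
  qed
qed

definition rot_map :: "(int \<Rightarrow> nat \<Rightarrow> real) \<Rightarrow> pt \<Rightarrow> pt" where
  "rot_map w y = (\<lambda>n. piece_rot (w n) (y n))"

definition rot_coupling :: "(int \<Rightarrow> nat \<Rightarrow> real) \<Rightarrow> (pt \<times> pt) measure" where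
  "rot_coupling w = graph_coupling (rot_map w)"

text \<open>Compact as a product of intervals, and short enough that an angle is determined by its
  class modulo 1.\<close>

definition rot_params :: "(int \<Rightarrow> nat \<Rightarrow> real) set" where
  "rot_params = {w. \<forall>n j. w n j \<in> {0..1/2}}"

lemma rot_map_mp: "rot_map w \<in> measure_preserving Ylam Ylam"
  unfolding rot_map_def[abs_def] by (rule product_map_mp) (rule piece_rot_mp)

text \<open>The inverse rotates by \<open>- w n j\<close>, in general outside
  \<open>rot_params\<close>; \<open>rot_map\<close> therefore accepts arbitrary real angles.\<close>

lemma rot_map_Aut: "rot_map w \<in> Aut Ylam"
proof -
  have inv: "AE y in Ylam. rot_map (\<lambda>n j. - w n j) (rot_map w y) = y" for w
    by (rule AE_I2) (auto simp: rot_map_def space_Ylam piece_rot_inverse)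
  from inv[of w] inv[of "\<lambda>n j. - w n j"] show ?thesis
    unfolding Aut_def using rot_map_mp by (intro CollectI conjI exI[of _ "rot_map (\<lambda>n j. - w n j)"]) auto
qed

lemma rot_coupling_AutC2: "rot_coupling w \<in> AutC2"
  unfolding rot_coupling_def AutC2_def using rot_map_Aut by blast

lemma rot_coupling_C2: "rot_coupling w \<in> C2"
  using rot_coupling_AutC2 AutC2_subset by blast

text \<open>Coordinate \<open>n\<close> of \<open>shiftT (rot_map w y)\<close> is coordinate
  \<open>n + 1\<close> of \<open>y\<close> rotated with row \<open>w (n + 1)\<close>, so the
  intertwining relation holds at every point.\<close>

lemma lensT_rot_coupling: "lensT shiftT (rot_coupling w) = rot_coupling (\<lambda>n. w (n + 1))"
  unfolding rot_coupling_def
  by (rule lensT_graph_coupling[OF shift_mp]) (auto intro!: measure_preserving_measurable rot_map_mp simp: shiftT_def rot_map_def)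

section \<open>Continuity and injectivity of the parametrization by angles\<close>

lemma tendsto_fun_component:
  fixes u :: "'k \<Rightarrow> 'i::countable \<Rightarrow> 'a::metric_space"
  assumes "(u \<longlongrightarrow> a) F"
  shows "((\<lambda>k. u k i) \<longlongrightarrow> a i) F"
proof -
  have "isCont (\<lambda>x::'i \<Rightarrow> 'a. x i) a"
    using continuous_on_eq_continuous_at[OF open_UNIV, of "\<lambda>x::'i \<Rightarrow> 'a. x i"]
      continuous_on_product_coordinates[of i] by simp
  then show ?thesis using assms by (rule isCont_tendsto_compose)
qed

text \<open>The parameters live in a metrizable countable product, so sequences decide continuity;
  along a convergent sequence each coordinate of the maps converges almost everywhere.\<close>

lemma continuous_map_rot_coupling: "continuous_map euclidean C2_top rot_coupling"
proof (rule continuous_map_into_C2)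
  show "rot_coupling ` topspace euclidean \<subseteq> C2" using rot_coupling_C2 by auto
  fix A B assume AB: "A \<in> sets Ylam" "B \<in> sets Ylam"
  have "continuous_on UNIV (\<lambda>w. measure (rot_coupling w) (A \<times> B))"
  proof (rule continuous_on_sequentiallyI)
    fix u :: "nat \<Rightarrow> int \<Rightarrow> nat \<Rightarrow> real" and a assume u: "u \<longlonglongrightarrow> a"
    show "(\<lambda>k. measure (rot_coupling (u k)) (A \<times> B)) \<longlonglongrightarrow> measure (rot_coupling a) (A \<times> B)"
      unfolding rot_coupling_def
    proof (rule graph_coupling_tendsto[OF rot_map_mp rot_map_mp _ AB(2,1)])
      fix i
      have "(\<lambda>k. u k i j) \<longlonglongrightarrow> a i j" for j
        using tendsto_fun_component[OF tendsto_fun_component[OF u]] .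
      then have "AE t in circ. (\<lambda>k. piece_rot (u k i) t) \<longlonglongrightarrow> piece_rot (a i) t" by (rule piece_rot_tendsto)
      then show "AE y in Ylam. (\<lambda>k. rot_map (u k) y i) \<longlonglongrightarrow> rot_map a y i"
        unfolding rot_map_def by (rule AE_measure_preserving[OF component_measure_preserving])
    qed
  qed
  then show "continuous_map euclidean euclideanreal (\<lambda>w. measure (rot_coupling w) (A \<times> B))" by simp
qed

text \<open>The graph of \<open>S'\<close> is measurable and carries all of its own graph coupling;
  by equality it also carries that of \<open>S\<close>.\<close>

lemma AE_eq_of_graph_coupling_eq:
  assumes S: "S \<in> Ylam \<rightarrow>\<^sub>M Ylam" and S': "S' \<in> Ylam \<rightarrow>\<^sub>M Ylam" and eq: "graph_coupling S = graph_coupling S'"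
  shows "AE y in Ylam. S y = S' y"
proof -
  let ?D = "{z \<in> space (Ylam \<Otimes>\<^sub>M Ylam). \<forall>n. fst z n = S' (snd z) n}"
  have D: "?D \<in> sets (Ylam \<Otimes>\<^sub>M Ylam)"
    by (intro sets.sets_Collect_countable_All borel_measurable_eq
        measurable_compose[OF measurable_fst measurable_Ylam_component]
        measurable_compose[OF measurable_compose[OF measurable_snd S'] measurable_Ylam_component])
  have "AE z in graph_coupling S'. \<forall>n. fst z n = S' (snd z) n"
    unfolding graph_coupling_def by (subst AE_distr_iff[OF graph_measurable[OF S'] D]) simp
  then have "AE z in graph_coupling S. \<forall>n. fst z n = S' (snd z) n" unfolding eq .
  then have "AE y in Ylam. \<forall>n. S y n = S' y n"
    unfolding graph_coupling_def by (subst (asm) AE_distr_iff[OF graph_measurable[OF S] D]) simp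
  then show ?thesis by (simp add: fun_eq_iff)
qed

lemma rot_coupling_inj: "inj_on rot_coupling rot_params"
proof (rule inj_onI)
  fix w v assume w: "w \<in> rot_params" and v: "v \<in> rot_params" and eq: "rot_coupling w = rot_coupling v"
  have "AE y in Ylam. rot_map w y = rot_map v y"
    using eq unfolding rot_coupling_def
    by (intro AE_eq_of_graph_coupling_eq measure_preserving_measurable rot_map_mp)
  then have AE: "AE y in Ylam. piece_rot (w n) (y n) = piece_rot (v n) (y n)" for n
    by (rule AE_mp) (auto intro!: AE_I2 simp: rot_map_def dest: fun_cong[of _ _ n])
  have "w n j = v n j" for n j
  proof -
    have m: "{t \<in> space circ. piece_rot (w n) t = piece_rot (v n) t} \<in> sets circ"
      using measurable_piece_rot measurable_circ_iff by (intro borel_measurable_eq) blast+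
    have "AE t in distr Ylam circ (\<lambda>y. y n). piece_rot (w n) t = piece_rot (v n) t"
      using AE by (subst AE_distr_iff[OF measurable_Ylam_component' m])
    then have "AE t in circ. piece_rot (w n) t = piece_rot (v n) t"
      unfolding measure_preserving_distr[OF component_measure_preserving] .
    then have "AE t in lborel. t \<in> {0..<1} \<longrightarrow> piece_rot (w n) t = piece_rot (v n) t"
      unfolding circ_def by (subst (asm) AE_restrict_space_iff) auto
    \<comment> \<open>A set of positive measure inside piece \<open>j\<close> must meet the set of
      agreement. The closed left half keeps the normalized position \<open>s\<close> at most 1/2,
      safely inside the piece.\<close>
    moreover have "\<not> (AE t in lborel. t \<notin> {left j..left j + len j/2})"
    proof
      assume "AE t in lborel. t \<notin> {left j..left j + len j/2}"
      then have "emeasure lborel {left j..left j + len j/2} = 0"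
        by (subst (asm) AE_iff_measurable[of "{left j..left j + len j/2}"]) auto
      then show False using len_pos[of j] by simp
    qed
    ultimately have "\<exists>t. t \<in> {left j..left j + len j/2} \<and> (t \<in> {0..<1} \<longrightarrow> piece_rot (w n) t = piece_rot (v n) t)"
      using eventually_mono[of "\<lambda>t. t \<in> {0..<1} \<longrightarrow> piece_rot (w n) t = piece_rot (v n) t" "ae_filter lborel"
          "\<lambda>t. t \<notin> {left j..left j + len j/2}"] by blast
    then obtain t where t: "t \<in> {left j..left j + len j/2}" "t \<in> {0..<1} \<longrightarrow> piece_rot (w n) t = piece_rot (v n) t"
      by blast
    define s where "s = (t - left j) / len j"
    have s: "0 \<le> s" "s < 1" "t = left j + len j * s" using t(1) len_pos[of j] by (auto simp: s_def field_simps)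
    have "t \<in> {0..<1}" using in_piece[OF s(1,2), of j] s(3) by simp
    then have "frac (s + w n j) = frac (s + v n j)"
      using t(2) len_pos[of j] unfolding s(3) piece_rot_eq[OF s(1,2)] by simp
    then have "w n j - v n j = of_int (\<lfloor>s + w n j\<rfloor> - \<lfloor>s + v n j\<rfloor>)" by (simp add: frac_def)
    then obtain m where m: "w n j - v n j = of_int m" by blast
    have "\<bar>w n j - v n j\<bar> \<le> 1/2"
    proof -
      have "0 \<le> w n j" "w n j \<le> 1/2" "0 \<le> v n j" "v n j \<le> 1/2"
        using w v unfolding rot_params_def by auto
      then show ?thesis by linarith
    qed
    then have "m = 0" unfolding m by linarith
    then show ?thesis using m by simp
  qed
  then show "w = v" by (intro ext)
qed

lemma compact_fun_all:
  fixes S :: "'a::topological_space set"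
  assumes "compact S"
  shows "compact {v :: 'i \<Rightarrow> 'a. \<forall>j. v j \<in> S}"
proof -
  have "compactin (product_topology (\<lambda>_. euclidean) UNIV) (Pi\<^sub>E UNIV (\<lambda>_::'i. S))"
    using assms by (simp add: compactin_PiE)
  moreover have "Pi\<^sub>E UNIV (\<lambda>_::'i. S) = {v. \<forall>j. v j \<in> S}" by (auto simp: PiE_def Pi_def)
  ultimately show ?thesis by (simp add: euclidean_product_topology)
qed

lemma compact_rot_params: "compact rot_params"
proof -
  have "rot_params = {w. \<forall>n. w n \<in> {v. \<forall>j. v j \<in> {0..1/2}}}" by (auto simp: rot_params_def)
  then show ?thesis using compact_fun_all[OF compact_fun_all[OF compact_Icc]] by metis
qed

text \<open>Gives Borel measurability of the inverse of \<open>rot_coupling\<close>, besides that of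
  its image.\<close>

lemma rot_coupling_closed_image:
  assumes "closed C" "C \<subseteq> rot_params"
  shows "closedin C2_top (rot_coupling ` C)"
proof -
  have "compact C" using compact_Int_closed[OF compact_rot_params assms(1)] assms(2) by (simp add: Int_absorb1)
  then have "compactin C2_top (rot_coupling ` C)"
    using image_compactin[OF _ continuous_map_rot_coupling] by simp
  then show ?thesis using Hausdorff_C2 compactin_imp_closedin by blast
qed

section \<open>Embedding topological and measure preserving systems\<close>

definition int_iter :: "('a \<Rightarrow> 'a) \<Rightarrow> ('a \<Rightarrow> 'a) \<Rightarrow> int \<Rightarrow> 'a \<Rightarrow> 'a" where
  "int_iter f g n = (if n \<ge> 0 then f ^^ nat n else g ^^ nat (- n))"

lemma int_iter_0 [simp]: "int_iter f g 0 x = x"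
  by (simp add: int_iter_def)

text \<open>The inverse relation is required at the starting point only: for negative
  \<open>n\<close> the first application of \<open>g\<close> cancels \<open>f\<close>. For
  measure-preserving systems this confines the exceptional set to the points with
  \<open>S' (S x) \<noteq> x\<close>.\<close>

lemma int_iter_step:
  assumes "g (f x) = x"
  shows "int_iter f g n (f x) = int_iter f g (n + 1) x"
proof (cases "n \<ge> 0")
  case True
  then have "nat (n + 1) = Suc (nat n)" by simp
  then show ?thesis using True by (simp add: int_iter_def funpow_swap1)
next
  case False
  \<comment> \<open>For \<open>n = -1\<close> the index \<open>n + 1 = 0\<close> falls into the
    other branch of \<open>int_iter\<close>; there \<open>m = 0\<close>, and both branches are the
    identity.\<close>
  define m where "m = nat (- n) - 1"
  have m: "nat (- n) = Suc m" "nat (- (n + 1)) = m" unfolding m_def using False by linarith+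
  have "(g ^^ Suc m) (f x) = (g ^^ m) x" by (simp add: funpow_swap1 assms)
  moreover have "n + 1 \<ge> 0 \<Longrightarrow> m = 0 \<and> nat (n + 1) = 0" using m False by linarith
  ultimately show ?thesis using False m by (auto simp: int_iter_def)
qed

lemma compact_dense_sequence:
  fixes K :: "'x::metric_space set"
  assumes "compact K"
  shows "\<exists>c :: nat \<Rightarrow> 'x. \<forall>x\<in>K. \<forall>e>0. \<exists>j. dist x (c j) < e"
proof -
  have "\<forall>n::nat. \<exists>F. finite F \<and> K \<subseteq> (\<Union>x\<in>F. ball x (1 / real (Suc n)))"
  proof
    fix n
    have "\<exists>F\<subseteq>K. finite F \<and> K \<subseteq> (\<Union>x\<in>F. ball x (1 / real (Suc n)))"
      by (rule compactE_image[OF assms, of K "\<lambda>x. ball x (1 / real (Suc n))"]) auto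
    then show "\<exists>F. finite F \<and> K \<subseteq> (\<Union>x\<in>F. ball x (1 / real (Suc n)))" by blast
  qed
  then obtain F where F: "\<And>n::nat. finite (F n)" "\<And>n. K \<subseteq> (\<Union>x\<in>F n. ball x (1 / real (Suc n)))" by metis
  \<comment> \<open>\<open>undefined\<close> keeps the set nonempty, so that it can be enumerated
    even for empty \<open>K\<close>; the points of the sequence may lie outside
    \<open>K\<close>.\<close>
  define C where "C = insert undefined (\<Union>n. F n)"
  have C: "countable C" "C \<noteq> {}" unfolding C_def using F(1) by (auto intro: countable_finite)
  show ?thesis
  proof (intro exI[of _ "from_nat_into C"] ballI allI impI)
    fix x :: 'x and e :: real assume "x \<in> K" "e > 0"
    obtain n where n: "1 / real (Suc n) < e" using nat_approx_posE[OF \<open>e > 0\<close>] .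
    obtain y where y: "y \<in> F n" "x \<in> ball y (1 / real (Suc n))" using F(2)[of n] \<open>x \<in> K\<close> by blast
    then have "y \<in> C" unfolding C_def by blast
    then obtain j where "from_nat_into C j = y" using C from_nat_into_surj by metis
    then show "\<exists>j. dist x (from_nat_into C j) < e" using y n by (auto simp: dist_commute intro!: exI[of _ j])
  qed
qed

lemma compact_system_embeds:
  fixes K :: "'x::metric_space set"
  assumes K: "compact K" and fg: "homeomorphism K K f g"
  shows "\<exists>h. homeomorphic_map (top_of_set K) (subtopology C2_top (h ` K)) h
              \<and> closedin C2_top (h ` K) \<and> h ` K \<subseteq> AutC2
              \<and> lensT shiftT ` (h ` K) = h ` K
              \<and> (\<forall>x\<in>K. h (f x) = lensT shiftT (h x))"
proof -
  obtain c :: "nat \<Rightarrow> 'x" where c: "\<forall>x\<in>K. \<forall>e>0. \<exists>j. dist x (c j) < e"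
    using compact_dense_sequence[OF K] by blast
  note f = homeomorphism_cont1[OF fg] homeomorphism_image1[OF fg]
    and g = homeomorphism_cont2[OF fg] homeomorphism_image2[OF fg]
    and gf = homeomorphism_apply1[OF fg]
  have pow: "continuous_on K (p ^^ n) \<and> (p ^^ n) ` K \<subseteq> K" if p: "continuous_on K p" "p ` K \<subseteq> K" for p :: "'x \<Rightarrow> 'x" and n
  proof (induction n)
    case 0
    show ?case by simp
  next
    case (Suc n)
    have "continuous_on K (\<lambda>x. p ((p ^^ n) x))"
      by (rule continuous_on_compose2[OF p(1)]) (use Suc in blast)+
    moreover have "(p ^^ Suc n) ` K \<subseteq> K"
    proof
      fix y assume "y \<in> (p ^^ Suc n) ` K"
      then obtain x where "x \<in> K" "y = p ((p ^^ n) x)" by (auto simp: comp_def)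
      then show "y \<in> K" using Suc p(2) by blast
    qed
    ultimately show ?case by (simp add: comp_def)
  qed
  have it: "continuous_on K (int_iter f g n)" "int_iter f g n ` K \<subseteq> K" for n
    using pow[OF f(1) equalityD1[OF f(2)]] pow[OF g(1) equalityD1[OF g(2)]]
    unfolding int_iter_def by (cases "n \<ge> 0"; simp)+
  \<comment> \<open>Truncation at 1 and halving bring the distances into the range of
    \<open>rot_params\<close>. Row 0 alone separates points, by density of the \<open>c j\<close>;
    the other rows record the orbit and make the map equivariant.\<close>
  define \<omega> where "\<omega> x = (\<lambda>n j. min 1 (dist (int_iter f g n x) (c j)) / 2)" for x
  have cont: "continuous_on K \<omega>"
    unfolding \<omega>_def
    by (intro continuous_on_coordinatewise_then_product continuous_intros it) simp
  have par: "\<omega> x \<in> rot_params" for x by (auto simp: \<omega>_def rot_params_def)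
  have inj: "inj_on \<omega> K"
  proof (rule inj_onI, rule ccontr)
    fix x y assume xy: "x \<in> K" "y \<in> K" "\<omega> x = \<omega> y" "x \<noteq> y"
    \<comment> \<open>Since \<open>e\<close> is below the cap 1, truncated distances smaller than
      \<open>e\<close> are true distances; two of them would add up to less than
      \<open>dist x y\<close>.\<close>
    define e where "e = min 1 (dist x y) / 2"
    have "e > 0" using xy by (simp add: e_def)
    then obtain j where j: "dist x (c j) < e" using c xy(1) by blast
    have "min 1 (dist x (c j)) = min 1 (dist y (c j))"
      using fun_cong[OF fun_cong[OF xy(3), of 0], of j] by (simp add: \<omega>_def)
    then have "dist y (c j) < e" using j by (simp add: e_def min_def split: if_splits)
    then show False using j dist_triangle2[of x y "c j"] by (simp add: e_def min_def split: if_splits)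
  qed
  have equi: "\<omega> (f x) = (\<lambda>n. \<omega> x (n + 1))" if "x \<in> K" for x
    using int_iter_step[of g f x] gf[OF that] by (simp add: \<omega>_def)
  define h where "h x = rot_coupling (\<omega> x)" for x
  have h_cont: "continuous_map (top_of_set K) C2_top h"
  proof -
    have "continuous_map (top_of_set K) euclidean \<omega>" using cont by simp
    then have "continuous_map (top_of_set K) C2_top (rot_coupling \<circ> \<omega>)"
      using continuous_map_rot_coupling by (rule continuous_map_compose)
    then show ?thesis by (simp add: comp_def h_def[abs_def])
  qed
  have h_inj: "inj_on h K"
    using comp_inj_on[OF inj inj_on_subset[OF rot_coupling_inj]] par by (auto simp: h_def[abs_def] comp_def)
  have hA: "h ` K \<subseteq> AutC2" using rot_coupling_AutC2 by (auto simp: h_def)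
  have "compactin C2_top (h ` K)" using image_compactin[OF _ h_cont, of K] K by (simp add: compactin_subtopology)
  then have "closedin C2_top (h ` K)" using Hausdorff_C2 compactin_imp_closedin by blast
  moreover have "homeomorphic_map (top_of_set K) (subtopology C2_top (h ` K)) h"
  proof (rule continuous_imp_homeomorphic_map)
    show "continuous_map (top_of_set K) (subtopology C2_top (h ` K)) h"
      using h_cont by (simp add: continuous_map_in_subtopology)
    show "compact_space (top_of_set K)" using K by (simp add: compact_space_subtopology)
    show "Hausdorff_space (subtopology C2_top (h ` K))" using Hausdorff_C2 by (rule Hausdorff_space_subtopology)
    show "h ` topspace (top_of_set K) = topspace (subtopology C2_top (h ` K))"
      using hA AutC2_subset by auto
    show "inj_on h (topspace (top_of_set K))" using h_inj by simp
  qed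
  moreover have eq: "h (f x) = lensT shiftT (h x)" if "x \<in> K" for x
    using equi[OF that] by (simp add: h_def lensT_rot_coupling)
  moreover have "lensT shiftT ` (h ` K) = h ` K"
  proof -
    have "lensT shiftT ` (h ` K) = h ` (f ` K)" using eq by (auto simp: image_image)
    then show ?thesis using f by simp
  qed
  ultimately show ?thesis using hA by blast
qed

text \<open>\<open>ergodic\<close> speaks of strictly invariant sets. The points whose forward orbit
  is eventually in \<open>B\<close> form such a set, because dropping the first iterate does not
  change eventual behaviour; along almost every orbit membership in \<open>B\<close> is constant, so
  this set equals \<open>B\<close> up to a null set.\<close>

lemma (in prob_space) ergodic_AE_invariant:
  assumes erg: "ergodic M S" and S: "S \<in> measure_preserving M M" and B: "B \<in> sets M"
    and inv: "AE x in M. S x \<in> B \<longleftrightarrow> x \<in> B"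
  shows "measure M B = 0 \<or> measure M B = 1"
proof -
  have Sm: "S \<in> M \<rightarrow>\<^sub>M M" using S by (rule measure_preserving_measurable)
  have Spow: "(S ^^ n) \<in> measure_preserving M M" for n
  proof (induction n)
    case 0
    show ?case by (simp add: measure_preserving_iff id_def)
  next
    case (Suc n)
    then show ?case using measure_preserving_comp[OF Suc S] by (simp add: comp_def)
  qed
  define B' where "B' = {x \<in> space M. \<exists>m. \<forall>n\<ge>m. (S ^^ n) x \<in> B}"
  have "{x \<in> space M. (S ^^ n) x \<in> B} \<in> sets M" for n
    using measurable_sets[OF measure_preserving_measurable[OF Spow] B] by (simp add: vimage_def Int_def conj_commute)
  then have B': "B' \<in> sets M" unfolding B'_def by measurable
  have "S -` B' \<inter> space M = B'"
  proof -
    have "(\<exists>m. \<forall>n\<ge>m. (S ^^ n) (S x) \<in> B) \<longleftrightarrow> (\<exists>m. \<forall>n\<ge>m. (S ^^ n) x \<in> B)" for x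
    proof
      assume "\<exists>m. \<forall>n\<ge>m. (S ^^ n) (S x) \<in> B"
      then obtain m where m: "\<And>n. n \<ge> m \<Longrightarrow> (S ^^ Suc n) x \<in> B" by (auto simp: funpow_swap1)
      have "(S ^^ n) x \<in> B" if "n \<ge> Suc m" for n
        using m[of "n - 1"] that by (cases n) auto
      then show "\<exists>m. \<forall>n\<ge>m. (S ^^ n) x \<in> B" by blast
    next
      assume "\<exists>m. \<forall>n\<ge>m. (S ^^ n) x \<in> B"
      then obtain m where m: "\<And>n. n \<ge> m \<Longrightarrow> (S ^^ n) x \<in> B" by blast
      have "(S ^^ n) (S x) \<in> B" if "n \<ge> m" for n
        using m[of "Suc n"] that by (simp add: funpow_swap1)
      then show "\<exists>m. \<forall>n\<ge>m. (S ^^ n) (S x) \<in> B" by blast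
    qed
    then show ?thesis using measurable_space[OF Sm] by (auto simp: B'_def)
  qed
  then have "measure M B' = 0 \<or> measure M B' = 1" using erg B' unfolding ergodic_def by blast
  moreover have "AE x in M. x \<in> B' \<longleftrightarrow> x \<in> B"
  proof -
    have "AE x in M. S ((S ^^ n) x) \<in> B \<longleftrightarrow> (S ^^ n) x \<in> B" for n
      by (rule AE_measure_preserving[OF Spow inv])
    then have "AE x in M. \<forall>n. (S ^^ Suc n) x \<in> B \<longleftrightarrow> (S ^^ n) x \<in> B"
      by (simp add: AE_all_countable)
    then show ?thesis
    proof (rule AE_mp, intro AE_I2 impI)
      fix x assume x: "x \<in> space M" and *: "\<forall>n. (S ^^ Suc n) x \<in> B \<longleftrightarrow> (S ^^ n) x \<in> B"
      have "(S ^^ n) x \<in> B \<longleftrightarrow> x \<in> B" for n by (induction n) (use * in auto)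
      then show "x \<in> B' \<longleftrightarrow> x \<in> B" using x by (auto simp: B'_def)
    qed
  qed
  then have "measure M B' = measure M B" using B B' by (intro finite_measure_eq_AE) auto
  ultimately show ?thesis by simp
qed

section \<open>The Borel structure of \<open>C2\<close> and the Borel inverse of the
  parametrization\<close>

definition C2_space :: "(pt \<times> pt) measure measure" where
  "C2_space = sigma C2 {U. openin C2_top U}"

lemma C2_open_Pow: "{U. openin C2_top U} \<subseteq> Pow C2"
  using openin_subset[of C2_top] by auto

lemma space_C2_space [simp]: "space C2_space = C2"
  unfolding C2_space_def using C2_open_Pow by (rule space_measure_of)

lemma sets_C2_space: "sets C2_space = C2_borel"
  unfolding C2_space_def C2_borel_def using C2_open_Pow by (rule sets_measure_of)

lemma C2_space_open: "openin C2_top U \<Longrightarrow> U \<in> sets C2_space"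
  unfolding sets_C2_space C2_borel_def by (auto intro: sigma_sets.Basic)

lemma C2_space_closed:
  assumes "closedin C2_top U"
  shows "U \<in> sets C2_space"
proof -
  have "U = space C2_space - (C2 - U)" using closedin_subset[OF assms] by auto
  moreover have "C2 - U \<in> sets C2_space" using assms by (intro C2_space_open) (simp add: closedin_def)
  ultimately show ?thesis using sets.compl_sets by metis
qed

lemma measurable_into_C2_space:
  assumes "\<And>x. x \<in> space M \<Longrightarrow> f x \<in> C2" "\<And>U. openin C2_top U \<Longrightarrow> f -` U \<inter> space M \<in> sets M"
  shows "f \<in> M \<rightarrow>\<^sub>M C2_space"
  unfolding C2_space_def by (rule measurable_measure_of[OF C2_open_Pow]) (use assms in auto)

lemma AutC2_measurable: "AutC2 \<in> sets C2_space"
proof -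
  obtain U where U: "\<And>n::nat. openin C2_top (U n)" "\<Inter> (range U) = AutC2"
    using gdelta_AutC2 unfolding gdelta_in_descending by blast
  have "\<Inter> (range U) \<in> sets C2_space" using C2_space_open[OF U(1)] by (intro sets.countable_INT) auto
  then show ?thesis using U(2) by simp
qed

lemma measurable_lensT: "lensT shiftT \<in> C2_space \<rightarrow>\<^sub>M C2_space"
proof (rule measurable_into_C2_space)
  show "\<rho> \<in> space C2_space \<Longrightarrow> lensT shiftT \<rho> \<in> C2" for \<rho> using lensT_in_C2[OF _ shift_mp] by simp
  fix U assume "openin C2_top U"
  from openin_continuous_map_preimage[OF continuous_map_lensT[OF shift_mp] this]
  have "openin C2_top (lensT shiftT -` U \<inter> C2)" by (simp add: vimage_def Int_def conj_commute)
  then show "lensT shiftT -` U \<inter> space C2_space \<in> sets C2_space" by (simp add: C2_space_open)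
qed

lemma measurable_rot_coupling: "rot_coupling \<in> borel \<rightarrow>\<^sub>M C2_space"
proof (rule measurable_into_C2_space)
  show "rot_coupling w \<in> C2" for w by (rule rot_coupling_C2)
  fix U assume "openin C2_top U"
  from openin_continuous_map_preimage[OF continuous_map_rot_coupling this]
  have "open (rot_coupling -` U)" by (simp add: vimage_def)
  then show "rot_coupling -` U \<inter> space borel \<in> sets borel" by simp
qed

definition rot_param_of :: "(pt \<times> pt) measure \<Rightarrow> int \<Rightarrow> nat \<Rightarrow> real" where
  "rot_param_of \<rho> = (if \<rho> \<in> rot_coupling ` rot_params then inv_into rot_params rot_coupling \<rho> else (\<lambda>_ _. 0))"

lemma rot_param_of_coupling: "w \<in> rot_params \<Longrightarrow> rot_param_of (rot_coupling w) = w"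
  using rot_coupling_inj by (simp add: rot_param_of_def)

lemma closed_rot_params: "closed rot_params"
  by (rule compact_imp_closed[OF compact_rot_params])

lemma rot_image_measurable: "rot_coupling ` rot_params \<in> sets C2_space"
  by (rule C2_space_closed[OF rot_coupling_closed_image[OF closed_rot_params order_refl]])

lemma measurable_rot_param_of: "(\<lambda>\<rho>. rot_param_of \<rho> n j) \<in> borel_measurable C2_space"
  unfolding borel_measurable_iff_le
proof
  fix a :: real
  let ?C = "{w. w n j \<le> a} \<inter> rot_params"
  have "closed {w :: int \<Rightarrow> nat \<Rightarrow> real. w n j \<le> a}"
    by (intro closed_Collect_le continuous_on_const
        continuous_on_product_then_coordinatewise[OF continuous_on_product_coordinates])
  then have "closed ?C" using closed_rot_params by (rule closed_Int)
  then have 1: "rot_coupling ` ?C \<in> sets C2_space"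
    by (intro C2_space_closed rot_coupling_closed_image) auto
  \<comment> \<open>The closed set \<open>?C\<close> has a closed image. Off the image of
    \<open>rot_params\<close> the value is the default 0, which contributes the whole complement
    exactly when \<open>0 \<le> a\<close>.\<close>
  have "{\<rho> \<in> space C2_space. rot_param_of \<rho> n j \<le> a}
      = rot_coupling ` ?C \<union> (if 0 \<le> a then space C2_space - rot_coupling ` rot_params else {})"
    using rot_coupling_C2 by (auto simp: rot_param_of_def rot_coupling_inj split: if_splits dest: inj_onD[OF rot_coupling_inj])
  also have "\<dots> \<in> sets C2_space" using 1 sets.compl_sets[OF rot_image_measurable] by auto
  finally show "{\<rho> \<in> space C2_space. rot_param_of \<rho> n j \<le> a} \<in> sets C2_space" .
qed

lemma ergodic_system_realized:
  fixes M :: "'w measure"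
  assumes std: "standard_prob_space M" and S: "S \<in> Aut M" and erg: "ergodic M S"
  shows "\<exists>P. space P = C2 \<and> sets P = C2_borel \<and> prob_space P
              \<and> lensT shiftT \<in> measure_preserving P P \<and> ergodic P (lensT shiftT)
              \<and> AutC2 \<in> sets P \<and> measure P AutC2 = 1
              \<and> mp_isomorphic P (lensT shiftT) M S"
proof -
  interpret M: prob_space M using std by (simp add: standard_prob_space_def)
  have "cantor_retract M"
    using std M.not_empty by (intro standard_borel_cantor_retract) (auto simp: standard_prob_space_def)
  then obtain E R where E: "E \<in> M \<rightarrow>\<^sub>M cantor" and R: "R \<in> cantor \<rightarrow>\<^sub>M M" and RE: "\<And>x. x \<in> space M \<Longrightarrow> R (E x) = x"
    unfolding cantor_retract_def by blast
  obtain S' where Smp: "S \<in> measure_preserving M M" and S'mp: "S' \<in> measure_preserving M M"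
    and SS: "AE x in M. S' (S x) = x"
    using S by (auto simp: Aut_def)
  note Sm = measure_preserving_measurable[OF Smp] and S'm = measure_preserving_measurable[OF S'mp]
  have "(p ^^ n) \<in> M \<rightarrow>\<^sub>M M" if p: "p \<in> M \<rightarrow>\<^sub>M M" for p and n :: nat
  proof (induction n)
    case (Suc n)
    then show ?case using measurable_compose[OF Suc p] by (simp add: comp_def)
  qed (simp add: id_def)
  then have it: "int_iter S S' n \<in> M \<rightarrow>\<^sub>M M" for n
    unfolding int_iter_def using Sm S'm by auto
  \<comment> \<open>Digits are stored as the extreme angles 0 and 1/2; row \<open>n\<close> holds
    the code of the \<open>n\<close>-th iterate, with the almost everywhere inverse
    \<open>S'\<close> used for negative \<open>n\<close>.\<close>
  define \<omega> where "\<omega> x = (\<lambda>n j. of_bool (E (int_iter S S' n x) j) / 2 :: real)" for x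
  have \<omega>c: "(\<lambda>x. \<omega> x n j) \<in> borel_measurable M" for n j
  proof -
    have "Measurable.pred M (\<lambda>x. E (int_iter S S' n x) j)"
      using measurable_compose[OF measurable_compose[OF it E] measurable_cantor_component] .
    then show ?thesis unfolding \<omega>_def of_bool_def by measurable
  qed
  then have \<omega>m: "\<omega> \<in> borel_measurable M"
    by (intro measurable_coordinatewise_then_product)
  have par: "\<omega> x \<in> rot_params" for x by (auto simp: \<omega>_def rot_params_def of_bool_def)
  define \<psi> where "\<psi> x = rot_coupling (\<omega> x)" for x
  have \<psi>m: "\<psi> \<in> M \<rightarrow>\<^sub>M C2_space"
    unfolding \<psi>_def by (rule measurable_compose[OF \<omega>m measurable_rot_coupling])
  \<comment> \<open>Row 0 is the code of the point itself, and 1/4 separates the two digit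
    values.\<close>
  define \<phi> where "\<phi> \<rho> = R (\<lambda>j. rot_param_of \<rho> 0 j \<ge> 1/4)" for \<rho>
  have \<phi>m: "\<phi> \<in> C2_space \<rightarrow>\<^sub>M M"
  proof -
    have "(\<lambda>\<rho> j. rot_param_of \<rho> 0 j \<ge> 1/4) \<in> C2_space \<rightarrow>\<^sub>M cantor"
      by (rule measurable_into_cantor) (use measurable_rot_param_of in measurable)
    then show ?thesis unfolding \<phi>_def using R by (rule measurable_compose)
  qed
  have \<phi>\<psi>: "\<phi> (\<psi> x) = x" if "x \<in> space M" for x
  proof -
    have "rot_param_of (\<psi> x) = \<omega> x" unfolding \<psi>_def by (rule rot_param_of_coupling[OF par])
    then have "(\<lambda>j. rot_param_of (\<psi> x) 0 j \<ge> 1/4) = E x"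
      by (auto simp: \<omega>_def of_bool_def)
    then show ?thesis unfolding \<phi>_def using RE[OF that] by simp
  qed
  have equi: "AE x in M. \<psi> (S x) = lensT shiftT (\<psi> x)"
    using SS
  proof eventually_elim
    case (elim x)
    have "\<omega> (S x) = (\<lambda>n. \<omega> x (n + 1))" using int_iter_step[of S' S x, OF elim] by (simp add: \<omega>_def)
    then show ?case by (simp add: \<psi>_def lensT_rot_coupling)
  qed
  define P where "P = distr M C2_space \<psi>"
  have spP: "space P = C2" and setP: "sets P = sets C2_space" by (simp_all add: P_def)
  have mP: "measurable P L = measurable C2_space L" "measurable L' P = measurable L' C2_space" for L :: "'l measure" and L' :: "'m measure"
    using setP by (simp_all cong: measurable_cong_sets)
  have prP: "prob_space P" unfolding P_def by (rule M.prob_space_distr[OF \<psi>m])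
  have \<psi>mp: "\<psi> \<in> measure_preserving M P"
    unfolding measure_preserving_iff mP using \<psi>m setP by (auto simp: P_def intro: distr_cong)
  have dP: "distr P L f = distr M L (\<lambda>x. f (\<psi> x))" if "f \<in> C2_space \<rightarrow>\<^sub>M L" for L :: "'l measure" and f
    unfolding P_def using distr_distr[OF that \<psi>m] by (simp add: comp_def)
  have lm: "lensT shiftT \<in> P \<rightarrow>\<^sub>M P" unfolding mP by (rule measurable_lensT)
  have lens\<psi>: "(\<lambda>x. lensT shiftT (\<psi> x)) \<in> measure_preserving M P"
    by (rule measure_preserving_cong_AE[OF measure_preserving_comp[OF Smp \<psi>mp]
          measurable_compose[OF measure_preserving_measurable[OF \<psi>mp] lm] equi])
  have lmp: "lensT shiftT \<in> measure_preserving P P"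
    unfolding measure_preserving_iff using lm measure_preserving_distr[OF lens\<psi>]
      distr_distr[OF lm measure_preserving_measurable[OF \<psi>mp]] measure_preserving_distr[OF \<psi>mp]
    by (simp add: comp_def)
  have ergP: "ergodic P (lensT shiftT)"
    unfolding ergodic_def
  proof (intro ballI impI)
    fix A assume A: "A \<in> sets P" and inv: "lensT shiftT -` A \<inter> space P = A"
    let ?B = "\<psi> -` A \<inter> space M"
    have B: "?B \<in> sets M" using measurable_sets[OF measure_preserving_measurable[OF \<psi>mp] A] .
    \<comment> \<open>The intertwining relation \<open>equi\<close> is known only almost everywhere,
      so the preimage of an invariant set is invariant only up to a null set.\<close>
    have "AE x in M. S x \<in> ?B \<longleftrightarrow> x \<in> ?B"
      using equi
    proof (rule AE_mp, intro AE_I2 impI)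
      fix x assume x: "x \<in> space M" and eq: "\<psi> (S x) = lensT shiftT (\<psi> x)"
      have "\<psi> x \<in> space P" using measurable_space[OF \<psi>m x] spP by simp
      then have "lensT shiftT (\<psi> x) \<in> A \<longleftrightarrow> \<psi> x \<in> A" using inv by blast
      then show "S x \<in> ?B \<longleftrightarrow> x \<in> ?B" using x eq measurable_space[OF Sm x] by simp
    qed
    then have "measure M ?B = 0 \<or> measure M ?B = 1"
      using M.ergodic_AE_invariant[OF erg Smp B] by blast
    moreover have "measure P A = measure M ?B"
      using \<psi>mp A by (simp add: measure_preserving_def measure_def)
    ultimately show "measure P A = 0 \<or> measure P A = 1" by simp
  qed
  have AutP: "AutC2 \<in> sets P" using AutC2_measurable setP by simp
  have "measure P AutC2 = 1"
  proof -
    have "\<psi> -` AutC2 \<inter> space M = space M" using rot_coupling_AutC2 by (auto simp: \<psi>_def)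
    moreover have "emeasure M (\<psi> -` AutC2 \<inter> space M) = emeasure P AutC2"
      using \<psi>mp AutP unfolding measure_preserving_def by blast
    ultimately show ?thesis using M.emeasure_space_1 by (simp add: measure_def)
  qed
  moreover have "mp_isomorphic P (lensT shiftT) M S"
    unfolding mp_isomorphic_def
  proof (intro exI conjI)
    have "distr P M \<phi> = distr M M (\<lambda>x. x)"
      unfolding dP[OF \<phi>m] by (rule distr_cong) (auto simp: \<phi>\<psi>)
    then show "\<phi> \<in> measure_preserving P M"
      unfolding measure_preserving_iff mP using \<phi>m by simp
    show "\<psi> \<in> measure_preserving M P" by (rule \<psi>mp)
    \<comment> \<open>The equation \<open>\<psi> (\<phi> \<rho>) = \<rho>\<close> is replaced by
      equality of all parameters on the image of \<open>rot_params\<close>, a countable family of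
      Borel conditions that can be checked in \<open>M\<close>.\<close>
    have "{\<rho> \<in> space C2_space. \<rho> \<in> rot_coupling ` rot_params \<and> (\<forall>n j. \<omega> (\<phi> \<rho>) n j = rot_param_of \<rho> n j)} \<in> sets C2_space"
      by (intro sets.sets_Collect_conj sets.sets_Collect_countable_All borel_measurable_eq
          measurable_compose[OF \<phi>m \<omega>c] measurable_rot_param_of)
         (use rot_image_measurable sets.sets_into_space[OF rot_image_measurable] in \<open>auto simp: Collect_conj_eq Int_absorb1\<close>)
    then have "AE \<rho> in P. \<rho> \<in> rot_coupling ` rot_params \<and> (\<forall>n j. \<omega> (\<phi> \<rho>) n j = rot_param_of \<rho> n j)"
      unfolding P_def
      by (subst AE_distr_iff[OF \<psi>m]) (auto simp: \<phi>\<psi> intro!: AE_I2, auto simp: \<psi>_def rot_param_of_coupling par)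
    then show "AE \<rho> in P. \<psi> (\<phi> \<rho>) = \<rho>"
    proof eventually_elim
      case (elim \<rho>)
      then obtain w where w: "w \<in> rot_params" "\<rho> = rot_coupling w" by blast
      have "\<omega> (\<phi> \<rho>) = w" using elim w rot_param_of_coupling by (intro ext) simp
      then show ?case using w by (simp add: \<psi>_def)
    qed
    show "AE x in M. \<phi> (\<psi> x) = x" by (rule AE_I2) (rule \<phi>\<psi>)
    have l\<phi>: "(\<lambda>\<rho>. \<phi> (lensT shiftT \<rho>)) \<in> C2_space \<rightarrow>\<^sub>M M" "(\<lambda>\<rho>. S (\<phi> \<rho>)) \<in> C2_space \<rightarrow>\<^sub>M M"
      using measurable_compose[OF measurable_lensT \<phi>m] measurable_compose[OF \<phi>m Sm] by auto
    \<comment> \<open>Equality of two \<open>M\<close>-valued maps is tested on the digits of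
      \<open>E\<close>: countably many measurable conditions, sufficient because \<open>R\<close>
      recovers the point.\<close>
    have D: "{\<rho> \<in> space C2_space. \<forall>j. E (\<phi> (lensT shiftT \<rho>)) j = E (S (\<phi> \<rho>)) j} \<in> sets C2_space"
    proof (rule sets.sets_Collect_countable_All)
      fix j
      have "Measurable.pred C2_space (\<lambda>\<rho>. E (\<phi> (lensT shiftT \<rho>)) j)" "Measurable.pred C2_space (\<lambda>\<rho>. E (S (\<phi> \<rho>)) j)"
        using l\<phi>[THEN measurable_compose, OF E, THEN measurable_compose, OF measurable_cantor_component] by auto
      then show "{\<rho> \<in> space C2_space. E (\<phi> (lensT shiftT \<rho>)) j = E (S (\<phi> \<rho>)) j} \<in> sets C2_space"
        by measurable
    qed
    have "AE x in M. \<forall>j. E (\<phi> (lensT shiftT (\<psi> x))) j = E (S (\<phi> (\<psi> x))) j"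
      using equi
    proof (rule AE_mp, intro AE_I2 impI)
      fix x assume x: "x \<in> space M" and eq: "\<psi> (S x) = lensT shiftT (\<psi> x)"
      have "\<phi> (lensT shiftT (\<psi> x)) = S x" using \<phi>\<psi>[OF measurable_space[OF Sm x]] eq by simp
      then show "\<forall>j. E (\<phi> (lensT shiftT (\<psi> x))) j = E (S (\<phi> (\<psi> x))) j" using \<phi>\<psi>[OF x] by simp
    qed
    then have "AE \<rho> in P. \<forall>j. E (\<phi> (lensT shiftT \<rho>)) j = E (S (\<phi> \<rho>)) j"
      unfolding P_def by (subst AE_distr_iff[OF \<psi>m D])
    then show "AE \<rho> in P. \<phi> (lensT shiftT \<rho>) = S (\<phi> \<rho>)"
    proof (rule AE_mp, intro AE_I2 impI)
      fix \<rho> assume r: "\<rho> \<in> space P" and *: "\<forall>j. E (\<phi> (lensT shiftT \<rho>)) j = E (S (\<phi> \<rho>)) j"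
      have "\<phi> (lensT shiftT \<rho>) \<in> space M" "S (\<phi> \<rho>) \<in> space M"
        using l\<phi>[THEN measurable_space] r spP by auto
      moreover have "E (\<phi> (lensT shiftT \<rho>)) = E (S (\<phi> \<rho>))" using * by (intro ext) simp
      ultimately show "\<phi> (lensT shiftT \<rho>) = S (\<phi> \<rho>)" using RE by metis
    qed
  qed
  ultimately show ?thesis
    using spP setP sets_C2_space prP lmp ergP AutP by blast
qed

theorem mainTheorem16:
  shows
   "shiftT \<in> Aut Ylam
    \<and> lensT shiftT ` AutC2 = AutC2 \<and> gdelta_in C2_top AutC2 \<and> C2_top closure_of AutC2 = C2
    \<and> (\<forall>(K::'x::metric_space set) f g. compact K \<and> homeomorphism K K f g \<and> top_transitive K f g \<longrightarrow>
         (\<exists>h. homeomorphic_map (top_of_set K) (subtopology C2_top (h ` K)) h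
              \<and> closedin C2_top (h ` K) \<and> h ` K \<subseteq> AutC2
              \<and> lensT shiftT ` (h ` K) = h ` K
              \<and> (\<forall>x\<in>K. h (f x) = lensT shiftT (h x))))
    \<and> (\<forall>(M::'w measure) S. standard_prob_space M \<and> S \<in> Aut M \<and> ergodic M S \<longrightarrow>
         (\<exists>P. space P = C2 \<and> sets P = C2_borel \<and> prob_space P
              \<and> lensT shiftT \<in> measure_preserving P P \<and> ergodic P (lensT shiftT)
              \<and> AutC2 \<in> sets P \<and> measure P AutC2 = 1
              \<and> mp_isomorphic P (lensT shiftT) M S))"
proof (intro conjI allI impI)
  show "shiftT \<in> Aut Ylam" unfolding Aut_iff_mp_iso using shift_mp_iso by blast
  show "lensT shiftT ` AutC2 = AutC2" by (rule lensT_AutC2[OF shift_mp_iso])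
  show "gdelta_in C2_top AutC2" by (rule gdelta_AutC2)
  show "C2_top closure_of AutC2 = C2" by (rule AutC2_dense)
  show "\<exists>h. homeomorphic_map (top_of_set K) (subtopology C2_top (h ` K)) h
              \<and> closedin C2_top (h ` K) \<and> h ` K \<subseteq> AutC2
              \<and> lensT shiftT ` (h ` K) = h ` K
              \<and> (\<forall>x\<in>K. h (f x) = lensT shiftT (h x))"
    if "compact K \<and> homeomorphism K K f g \<and> top_transitive K f g" for K :: "'x set" and f g
    by (rule compact_system_embeds) (use that in auto)
  show "\<exists>P. space P = C2 \<and> sets P = C2_borel \<and> prob_space P
              \<and> lensT shiftT \<in> measure_preserving P P \<and> ergodic P (lensT shiftT)
              \<and> AutC2 \<in> sets P \<and> measure P AutC2 = 1
              \<and> mp_isomorphic P (lensT shiftT) M S"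
    if "standard_prob_space M \<and> S \<in> Aut M \<and> ergodic M S" for M :: "'w measure" and S
    by (rule ergodic_system_realized) (use that in auto)
qed

end
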